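(* Let $n\ge1$ be finite and $\lambda\in(0,1]$. (Type 2 dual game.) For every $p\in\Delta(\mathcal K)$ and $\nu\in\mathbb R^{|\mathcal L|}$, the value of the type 2 dual game $\tilde\Gamma^2_{n,\lambda}(p,\nu)$ satisfies $$w^2_{n,\lambda}(p,\nu)=\max_R\max_{U_{\mathcal J}}\max_{U_0}\ U_0$$ over real variables $U_0$, $R_{\mathcal I_t}(a_t)$ ($t=1,\dots,n$), $U_{\mathcal J_t}$ ($t=1,\dots,n+1$), subject to $$\nu(l)+U_{\mathcal J_1}\ge U_0\quad\forall l\in\mathcal L,\ \mathcal J_1=\{l\},$$ $$\sum_{k_1,\dots,k_t}\sum_{a_t}R_{\mathcal I_t}(a_t)\lambda^{t-1}G_{k_t,l_t}(a_t,b_t)+\sum_{l_{t+1}}\sum_{a_t}Q_{a_t,b_t}(l_t,l_{t+1})U_{\mathcal J_{t+1}}\ge U_{\mathcal J_t}\quad\forall t=1,\dots,n,\ \forall b_t,\ \forall\mathcal J_t,$$ $$\sum_{a_t}R_{\mathcal I_t}(a_t)=P_{a_{t-1},b_{t-1}}(k_{t-1},k_t)R_{\mathcal I_{t-1}}(a_{t-1})\quad\forall t=1,\dots,n,\ \forall\mathcal I_t,$$ $$U_{\mathcal J_{n+1}}=0\ \ \forall\mathcal J_{n+1},\qquad R_{\mathcal I_t}(a_t)\ge0\ \ \forall t,\mathcal I_t,a_t,$$ where $\mathcal J_{t+1}=(\mathcal J_t,a_t,b_t,l_{t+1})$. If $R^*$ is the $R$-part of an optimal solution, then $$\sigma_t^{*a_t}(\mathcal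 I_t)=\frac{R^*_{\mathcal I_t}(a_t)}{P_{a_{t-1},b_{t-1}}(k_{t-1},k_t)R^*_{\mathcal I_{t-1}}(a_{t-1})}$$ (for all $\mathcal I_t$ at which the denominator is nonzero; arbitrary elsewhere) is an optimal strategy of player 1 in $\tilde\Gamma^2_{n,\lambda}(p,\nu)$. (Type 1 dual game.) For every $\mu\in\mathbb R^{|\mathcal K|}$ and $q\in\Delta(\mathcal L)$, the value of the type 1 dual game $\tilde\Gamma^1_{n,\lambda}(\mu,q)$ satisfies $$w^1_{n,\lambda}(\mu,q)=\min_S\min_{Z_{\mathcal I}}\min_{Z_0}\ Z_0$$ over real variables $Z_0$, $S_{\mathcal J_t}(b_t)$ ($t=1,\dots,n$), $Z_{\mathcal I_t}$ ($t=1,\dots,n+1$), subject to $$\mu(k)+Z_{\mathcal I_1}\le Z_0\quad\forall k\in\mathcal K,\ \mathcal I_1=\{k\},$$ $$\sum_{l_1,\dots,l_t}\sum_{b_t}S_{\mathcal J_t}(b_t)\lambda^{t-1}G_{k_t,l_t}(a_t,b_t)+\sum_{k_{t+1}}\sum_{b_t}P_{a_t,b_t}(k_t,k_{t+1})Z_{\mathcal I_{t+1}}\le Z_{\mathcal I_t}\quad\forall t=1,\dots,n,\ \forall a_t,\ \forall\mathcal I_t,$$ $$\sum_{b_t}S_{\mathcal J_t}(b_t)=Q_{a_{t-1},b_{t-1}}(l_{t-1},l_t)S_{\mathcal J_{t-1}}(b_{t-1})\quad\forall t=1,\dots,n,\ \forall\mathcal J_t,$$ $$Z_{\mathcal I_{n+1}}=0\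 \ \forall\mathcal I_{n+1},\qquad S_{\mathcal J_t}(b_t)\ge0\ \ \forall t,\mathcal J_t,b_t,$$ where $\mathcal I_{t+1}=(\mathcal I_t,a_t,b_t,k_{t+1})$. If $S^*$ is the $S$-part of an optimal solution, then $$\tau_t^{*b_t}(\mathcal J_t)=\frac{S^*_{\mathcal J_t}(b_t)}{Q_{a_{t-1},b_{t-1}}(l_{t-1},l_t)S^*_{\mathcal J_{t-1}}(b_{t-1})}$$ (for all $\mathcal J_t$ at which the denominator is nonzero; arbitrary elsewhere) is an optimal strategy of player 2 in $\tilde\Gamma^1_{n,\lambda}(\mu,q)$.
   Context: Primal game. $\mathcal K,\mathcal L$ (states of players 1, 2) and $\mathcal A,\mathcal B$ (actions of players 1, 2) are non-empty finite sets. $G_{k,l}\in\mathbb R^{|\mathcal A|\times|\mathcal B|}$ has non-negative entries $G_{k,l}(a,b)$ (payoff to player 1, cost to player 2). $p\in\Delta(\mathcal K)$, $q\in\Delta(\mathcal L)$ are initial distributions. For each $(a,b)$, $P_{a,b}(k,k')$ and $Q_{a,b}(l,l')$ are transition probabilities (row-stochastic). In the primal game, $k_1\sim p$ and $l_1\sim q$ are drawn independently by nature; for $t\ge2$, $k_t$ and $l_t$ are drawn independently according to $P_{a_{t-1},b_{t-1}}(k_{t-1},\cdot)$ and $Q_{a_{t-1},b_{t-1}}(l_{t-1},\cdot)$. Player 1 sees only the states $k_t$, player 2 only the states $l_t$. At every stage the players choose $a_t,b_t$ simultaneously and both then observe $(a_t,b_t)$; payoffs are not observed during play. $\mathcal I_t=(k_1,a_1,b_1,\dots,k_{t-1},a_{t-1},b_{t-1},k_t)$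 and $\mathcal J_t=(l_1,a_1,b_1,\dots,l_{t-1},a_{t-1},b_{t-1},l_t)$ are the information of players 1 and 2 at stage $t$. Behavior strategies are $\sigma=(\sigma_t)$, $\tau=(\tau_t)$ with $\sigma_t(\mathcal I_t)\in\Delta(\mathcal A)$, $\tau_t(\mathcal J_t)\in\Delta(\mathcal B)$; $\sigma_t^{a}(\mathcal I_t)$, $\tau_t^{b}(\mathcal J_t)$ are the probabilities of $a$, $b$. Dual games (player 1 maximizes, player 2 minimizes). The type 1 dual game $\tilde\Gamma^1_{n,\lambda}(\mu,q)$, $\mu\in\mathbb R^{|\mathcal K|}$, is played as the primal game except that player 1 itself chooses the distribution $p\in\Delta(\mathcal K)$ of its initial state (as part of its strategy, unobserved by player 2); its payoff is $E_{p,q,\sigma,\tau}\big(\mu(k_1)+\sum_{t=1}^n\lambda^{t-1}G_{k_t,l_t}(a_t,b_t)\big)$, and $w^1_{n,\lambda}(\mu,q)$ is its value (max over $(p,\sigma)$, min over $\tau$). The type 2 dual game $\tilde\Gamma^2_{n,\lambda}(p,\nu)$, $\nu\in\mathbb R^{|\mathcal L|}$, is played as the primal game except that player 2 itself chooses the distribution $q\in\Delta(\mathcal L)$ of its initial state (as part of its strategy, unobserved by player 1); its payoff is $E_{p,q,\sigma,\tau}\big(\nu(l_1)+\sum_{t=1}^n\lambda^{t-1}G_{k_t,l_t}(a_t,b_t)\big)$, and $w^2_{n,\lambda}(p,\nu)$ is its value (max over $\sigma$, min over $(q,\tau)$). Optimal strategies are those guaranteeing the value. Conventions. $R_{\mathcal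 I_0}(a_0)=p(k_1)$, $P_{a_0,b_0}(k_0,k_1)=1$, $S_{\mathcal J_0}(b_0)=q(l_1)$, $Q_{a_0,b_0}(l_0,l_1)=1$. In $\sum_{k_1,\dots,k_t}R_{\mathcal I_t}(a_t)$ with $\mathcal J_t$ fixed, $\mathcal I_t$ is formed from $k_1,\dots,k_t$ and the actions contained in $\mathcal J_t$; symmetrically for $\sum_{l_1,\dots,l_t}S_{\mathcal J_t}(b_t)$ with $\mathcal I_t$ fixed. For $\mathcal I_t$ with $t\ge2$, $\mathcal I_{t-1}$ and $a_{t-1},b_{t-1},k_{t-1}$ are those contained in $\mathcal I_t$ (similarly for $\mathcal J_t$). *)

theory Defs
  imports "HOL-Probability.Probability_Mass_Function"
begin

text \<open>
  A player's information at stage \<open>t\<close> is \<open>(s\<^sub>1,a\<^sub>1,b\<^sub>1,\<dots>,s\<^sub>t)\<close>: \<open>Init s\<close> is \<open>(s)\<close>, and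
  \<open>Step I a b s\<close> is \<open>(I,a,b,s)\<close>.  With \<open>'s = 'k\<close> this is the information of player 1, with
  \<open>'s = 'l\<close> that of player 2, and with \<open>'s = 'k \<times> 'l\<close> the full history of the play, whose images
  under \<open>map_info fst\<close> and \<open>map_info snd\<close> are what the two players have seen of it.
\<close>

datatype ('s, dead 'a, dead 'b) info =
  Init 's
| Step "('s, 'a, 'b) info" 'a 'b 's

primrec stage :: "('s, 'a, 'b) info \<Rightarrow> nat" where
  "stage (Init s) = 1"
| "stage (Step I a b s) = Suc (stage I)"

primrec first_state :: "('s, 'a, 'b) info \<Rightarrow> 's" where
  "first_state (Init s) = s"
| "first_state (Step I a b s) = first_state I"

primrec cur_state :: "('s, 'a, 'b) info \<Rightarrow> 's" where
  "cur_state (Init s) = s"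
| "cur_state (Step I a b s) = s"

primrec actions :: "('s, 'a, 'b) info \<Rightarrow> ('a \<times> 'b) list" where
  "actions (Init s) = []"
| "actions (Step I a b s) = (a, b) # actions I"

lemma finite_same_actions: "finite {I :: ('s::finite, 'a, 'b) info. actions I = h}"
proof (induction h)
  case Nil
  have "{I :: ('s, 'a, 'b) info. actions I = []} \<subseteq> range Init"
  proof
    fix I :: "('s, 'a, 'b) info"
    assume "I \<in> {I. actions I = []}"
    then show "I \<in> range Init" by (cases I) auto
  qed
  then show ?case by (rule finite_subset) simp
next
  case (Cons x h)
  obtain a b where x: "x = (a, b)" by (cases x)
  have "{I :: ('s, 'a, 'b) info. actions I = x # h}
      \<subseteq> (\<lambda>(I, s). Step I a b s) ` ({I. actions I = h} \<times> UNIV)"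
  proof
    fix I :: "('s, 'a, 'b) info"
    assume "I \<in> {I. actions I = x # h}"
    then show "I \<in> (\<lambda>(I, s). Step I a b s) ` ({I. actions I = h} \<times> UNIV)"
      using x by (cases I) auto
  qed
  then show ?case by (rule finite_subset) (simp add: Cons)
qed


text \<open>
  \<open>play P Q p q \<sigma> \<tau> t\<close> is the law of the history at stage \<open>t + 1\<close>, that is, after \<open>t\<close> pairs of
  actions.
\<close>

primrec play ::
  "('a \<Rightarrow> 'b \<Rightarrow> 'k \<Rightarrow> 'k pmf) \<Rightarrow> ('a \<Rightarrow> 'b \<Rightarrow> 'l \<Rightarrow> 'l pmf) \<Rightarrow> 'k pmf \<Rightarrow> 'l pmf
    \<Rightarrow> (('k, 'a, 'b) info \<Rightarrow> 'a pmf) \<Rightarrow> (('l, 'a, 'b) info \<Rightarrow> 'b pmf)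
    \<Rightarrow> nat \<Rightarrow> ('k \<times> 'l, 'a, 'b) info pmf" where
  "play P Q p q \<sigma> \<tau> 0 = map_pmf Init (pair_pmf p q)"
| "play P Q p q \<sigma> \<tau> (Suc t) =
     bind_pmf (play P Q p q \<sigma> \<tau> t) (\<lambda>H.
     bind_pmf (pair_pmf (\<sigma> (map_info fst H)) (\<tau> (map_info snd H))) (\<lambda>(a, b).
     map_pmf (Step H a b)
       (pair_pmf (P a b (fst (cur_state H))) (Q a b (snd (cur_state H))))))"

text \<open>
  The discounted sum of the stage payoffs of all completed stages of a history; the stage at which
  the history ends does not count, as no actions have been taken there yet.
\<close>

primrec total_payoff ::
  "('k \<Rightarrow> 'l \<Rightarrow> 'a \<Rightarrow> 'b \<Rightarrow> real) \<Rightarrow> real \<Rightarrow> ('k \<times> 'l, 'a, 'b) info \<Rightarrow> real" where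
  "total_payoff G lam (Init s) = 0"
| "total_payoff G lam (Step H a b s) =
     total_payoff G lam H
     + lam ^ (stage H - 1) * G (fst (cur_state H)) (snd (cur_state H)) a b"

definition dual1_payoff where
  "dual1_payoff G P Q n lam \<mu> q = (\<lambda>(p, \<sigma>) \<tau>.
     measure_pmf.expectation (play P Q p q \<sigma> \<tau> n)
       (\<lambda>H. \<mu> (fst (first_state H)) + total_payoff G lam H))"

definition dual2_payoff where
  "dual2_payoff G P Q n lam p \<nu> = (\<lambda>\<sigma> (q, \<tau>).
     measure_pmf.expectation (play P Q p q \<sigma> \<tau> n)
       (\<lambda>H. \<nu> (snd (first_state H)) + total_payoff G lam H))"


text \<open>
  Zero-sum games in normal form \<open>pay x y\<close>, where \<open>x\<close> maximizes, \<open>y\<close> minimizes, and every element of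
  the types of \<open>x\<close> and \<open>y\<close> is a strategy.
\<close>

definition guarantees_max :: "('x \<Rightarrow> 'y \<Rightarrow> real) \<Rightarrow> 'x \<Rightarrow> real \<Rightarrow> bool" where
  "guarantees_max pay x v \<longleftrightarrow> (\<forall>y. v \<le> pay x y)"

definition guarantees_min :: "('x \<Rightarrow> 'y \<Rightarrow> real) \<Rightarrow> 'y \<Rightarrow> real \<Rightarrow> bool" where
  "guarantees_min pay y v \<longleftrightarrow> (\<forall>x. pay x y \<le> v)"

definition is_game_value :: "('x \<Rightarrow> 'y \<Rightarrow> real) \<Rightarrow> real \<Rightarrow> bool" where
  "is_game_value pay v \<longleftrightarrow> (\<exists>x. guarantees_max pay x v) \<and> (\<exists>y. guarantees_min pay y v)"

lemma is_game_value_unique: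
  assumes "is_game_value pay v" and "is_game_value pay w"
  shows "v = w"
proof -
  have le: "v \<le> w" if v: "is_game_value pay v" and w: "is_game_value pay w" for v w
  proof -
    obtain x where x: "\<forall>y. v \<le> pay x y"
      using v unfolding is_game_value_def guarantees_max_def by (elim conjE exE)
    obtain y where y: "\<forall>x. pay x y \<le> w"
      using w unfolding is_game_value_def guarantees_min_def by (elim conjE exE)
    show ?thesis using order.trans[OF x[rule_format] y[rule_format]] .
  qed
  show ?thesis using le[OF assms] le[OF assms(2) assms(1)] by (rule order.antisym)
qed

definition optimal_max :: "('x \<Rightarrow> 'y \<Rightarrow> real) \<Rightarrow> 'x \<Rightarrow> bool" where
  "optimal_max pay x \<longleftrightarrow> (\<exists>v. is_game_value pay v \<and> guarantees_max pay x v)"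

definition optimal_min :: "('x \<Rightarrow> 'y \<Rightarrow> real) \<Rightarrow> 'y \<Rightarrow> bool" where
  "optimal_min pay y \<longleftrightarrow> (\<exists>v. is_game_value pay v \<and> guarantees_min pay y v)"


text \<open>
  The quantities \<open>P\<^bsub>a,b\<^esub>(k\<^sub>t\<^sub>-\<^sub>1,k\<^sub>t) R(I\<^sub>t\<^sub>-\<^sub>1)(a)\<close> and \<open>Q\<^bsub>a,b\<^esub>(l\<^sub>t\<^sub>-\<^sub>1,l\<^sub>t) S(J\<^sub>t\<^sub>-\<^sub>1)(b)\<close>, where
  \<open>a, b\<close> are the actions of stage \<open>t - 1\<close>.  The equations for \<open>Init\<close> are the conventions for
  \<open>t = 1\<close>.
\<close>

primrec weight1 ::
  "('a \<Rightarrow> 'b \<Rightarrow> 'k \<Rightarrow> 'k pmf) \<Rightarrow> 'k pmf \<Rightarrow> (('k, 'a, 'b) info \<Rightarrow> 'a \<Rightarrow> real)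
    \<Rightarrow> ('k, 'a, 'b) info \<Rightarrow> real" where
  "weight1 P p R (Init k) = pmf p k"
| "weight1 P p R (Step I a b k) = pmf (P a b (cur_state I)) k * R I a"

primrec weight2 ::
  "('a \<Rightarrow> 'b \<Rightarrow> 'l \<Rightarrow> 'l pmf) \<Rightarrow> 'l pmf \<Rightarrow> (('l, 'a, 'b) info \<Rightarrow> 'b \<Rightarrow> real)
    \<Rightarrow> ('l, 'a, 'b) info \<Rightarrow> real" where
  "weight2 Q q S (Init l) = pmf q l"
| "weight2 Q q S (Step J a b l) = pmf (Q a b (cur_state J)) l * S J b"

text \<open>
  The variables of the linear programs are functions on all of \<open>info\<close>, but only their values at
  stages up to \<open>n\<close> (\<open>R\<close>, \<open>S\<close>) or \<open>n + 1\<close> (\<open>U\<close>, \<open>Z\<close>) are constrained or matter.  Summing over the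
  \<open>I\<close> with \<open>actions I = actions J\<close> is summing over \<open>k\<^sub>1,\<dots>,k\<^sub>t\<close> with the actions taken from \<open>J\<close>
  (a finite sum by \<open>finite_same_actions\<close>).
\<close>

definition lp2_feasible ::
  "('k::finite \<Rightarrow> 'l::finite \<Rightarrow> 'a::finite \<Rightarrow> 'b::finite \<Rightarrow> real)
    \<Rightarrow> ('a \<Rightarrow> 'b \<Rightarrow> 'k \<Rightarrow> 'k pmf) \<Rightarrow> ('a \<Rightarrow> 'b \<Rightarrow> 'l \<Rightarrow> 'l pmf) \<Rightarrow> nat \<Rightarrow> real
    \<Rightarrow> 'k pmf \<Rightarrow> ('l \<Rightarrow> real)
    \<Rightarrow> (('k, 'a, 'b) info \<Rightarrow> 'a \<Rightarrow> real) \<Rightarrow> (('l, 'a, 'b) info \<Rightarrow> real) \<Rightarrow> real \<Rightarrow> bool" where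
  "lp2_feasible G P Q n lam p \<nu> R U U0 \<longleftrightarrow>
     (\<forall>l. \<nu> l + U (Init l) \<ge> U0) \<and>
     (\<forall>J b. stage J \<le> n \<longrightarrow>
        (\<Sum>I | actions I = actions J. \<Sum>a\<in>UNIV.
            R I a * lam ^ (stage J - 1) * G (cur_state I) (cur_state J) a b)
        + (\<Sum>l\<in>UNIV. \<Sum>a\<in>UNIV. pmf (Q a b (cur_state J)) l * U (Step J a b l))
        \<ge> U J) \<and>
     (\<forall>I. stage I \<le> n \<longrightarrow> (\<Sum>a\<in>UNIV. R I a) = weight1 P p R I) \<and>
     (\<forall>J. stage J = n + 1 \<longrightarrow> U J = 0) \<and>
     (\<forall>I a. stage I \<le> n \<longrightarrow> R I a \<ge> 0)"

definition lp2_optimal where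
  "lp2_optimal G P Q n lam p \<nu> R U U0 \<longleftrightarrow>
     lp2_feasible G P Q n lam p \<nu> R U U0 \<and>
     (\<forall>R' U' U0'. lp2_feasible G P Q n lam p \<nu> R' U' U0' \<longrightarrow> U0' \<le> U0)"

definition lp1_feasible ::
  "('k::finite \<Rightarrow> 'l::finite \<Rightarrow> 'a::finite \<Rightarrow> 'b::finite \<Rightarrow> real)
    \<Rightarrow> ('a \<Rightarrow> 'b \<Rightarrow> 'k \<Rightarrow> 'k pmf) \<Rightarrow> ('a \<Rightarrow> 'b \<Rightarrow> 'l \<Rightarrow> 'l pmf) \<Rightarrow> nat \<Rightarrow> real
    \<Rightarrow> ('k \<Rightarrow> real) \<Rightarrow> 'l pmf
    \<Rightarrow> (('l, 'a, 'b) info \<Rightarrow> 'b \<Rightarrow> real) \<Rightarrow> (('k, 'a, 'b) info \<Rightarrow> real) \<Rightarrow> real \<Rightarrow> bool" where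
  "lp1_feasible G P Q n lam \<mu> q S Z Z0 \<longleftrightarrow>
     (\<forall>k. \<mu> k + Z (Init k) \<le> Z0) \<and>
     (\<forall>I a. stage I \<le> n \<longrightarrow>
        (\<Sum>J | actions J = actions I. \<Sum>b\<in>UNIV.
            S J b * lam ^ (stage I - 1) * G (cur_state I) (cur_state J) a b)
        + (\<Sum>k\<in>UNIV. \<Sum>b\<in>UNIV. pmf (P a b (cur_state I)) k * Z (Step I a b k))
        \<le> Z I) \<and>
     (\<forall>J. stage J \<le> n \<longrightarrow> (\<Sum>b\<in>UNIV. S J b) = weight2 Q q S J) \<and>
     (\<forall>I. stage I = n + 1 \<longrightarrow> Z I = 0) \<and>
     (\<forall>J b. stage J \<le> n \<longrightarrow> S J b \<ge> 0)"

definition lp1_optimal where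
  "lp1_optimal G P Q n lam \<mu> q S Z Z0 \<longleftrightarrow>
     lp1_feasible G P Q n lam \<mu> q S Z Z0 \<and>
     (\<forall>S' Z' Z0'. lp1_feasible G P Q n lam \<mu> q S' Z' Z0' \<longrightarrow> Z0 \<le> Z0')"

definition induced_by_R where
  "induced_by_R P n p R \<sigma> \<longleftrightarrow>
     (\<forall>I. stage I \<le> n \<and> weight1 P p R I \<noteq> 0 \<longrightarrow>
        (\<forall>a. pmf (\<sigma> I) a = R I a / weight1 P p R I))"

definition induced_by_S where
  "induced_by_S Q n q S \<tau> \<longleftrightarrow>
     (\<forall>J. stage J \<le> n \<and> weight2 Q q S J \<noteq> 0 \<longrightarrow>
        (\<forall>b. pmf (\<tau> J) b = S J b / weight2 Q q S J))"

end

theory Submission imports Defs begin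

text \<open>
  In terms of the realization plans \<open>R I a\<close> and \<open>S J b\<close> of the two players (the player's own
  contribution to the probability of reaching an information state and acting there) the payoff is
  bilinear, and the sets of plans are convex and compact in the product topology, so a minimax
  theorem yields the value.  For a fixed plan \<open>R\<close> of player 1, the constraints on \<open>U\<close> say that
  \<open>U J\<close> is at most the cost-to-go of a best response of player 2, so the largest feasible \<open>U0\<close> is
  exactly what \<open>R\<close> guarantees.  The type 1 game is the type 2 game with the players exchanged
  and the payoff negated.
\<close>

subsection \<open>A minimax theorem for compact convexlike games\<close>

text \<open>Behavior strategies themselves are unsuitable for a minimax argument: a choice at a late
  stage is multiplied by the choices of earlier stages, so averaging two strategies pointwise does
  not average their payoffs. Nothing is lost by passing to plans. Where a state has nonzero own
  weight, the plan determines the behavior there by division; elsewhere all choices produce the same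
  plan.

  Information states of every length are kept, so a plan is a point of an infinite product of real
  lines. The minimax theorem therefore asks only for topologies on the two sets and, in place of
  convexity, for a point at least as good as any given mixture of two others.

  Linear programming duality is not invoked. The value comes from minimax, and one identity that
  telescopes along the stages gives both directions: it bounds \<open>U0\<close> for every feasible
  \<open>U\<close> and is tight for the cost-to-go. The constraint on \<open>U0\<close> for every
  \<open>l\<close> reflects that player 2 picks its initial law: a linear function on the simplex
  has its minimum at a vertex.\<close>

definition concavelike_on :: "'x set \<Rightarrow> 'y set \<Rightarrow> ('x \<Rightarrow> 'y \<Rightarrow> real) \<Rightarrow> bool" where
  "concavelike_on X Y F \<longleftrightarrow>
     (\<forall>x1\<in>X. \<forall>x2\<in>X. \<forall>t. 0 \<le> t \<and> t \<le> 1 \<longrightarrow>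
        (\<exists>x\<in>X. \<forall>y\<in>Y. t * F x1 y + (1 - t) * F x2 y \<le> F x y))"

text \<open>Phrased through the transposed and negated payoff, so that exchanging the players in a
  minimax argument amounts to unfolding.\<close>

definition convexlike_on :: "'x set \<Rightarrow> 'y set \<Rightarrow> ('x \<Rightarrow> 'y \<Rightarrow> real) \<Rightarrow> bool" where
  "convexlike_on X Y F \<longleftrightarrow> concavelike_on Y X (\<lambda>y x. - F x y)"

lemma concavelike_onE:
  assumes "concavelike_on X Y F" "x1 \<in> X" "x2 \<in> X" "0 \<le> t" "t \<le> 1"
  obtains x where "x \<in> X" "\<And>y. y \<in> Y \<Longrightarrow> t * F x1 y + (1 - t) * F x2 y \<le> F x y"
  using assms unfolding concavelike_on_def by blast

lemma convexlike_onE: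
  assumes "convexlike_on X Y F" "y1 \<in> Y" "y2 \<in> Y" "0 \<le> t" "t \<le> 1"
  obtains y where "y \<in> Y" "\<And>x. x \<in> X \<Longrightarrow> F x y \<le> t * F x y1 + (1 - t) * F x y2"
proof -
  from assms have "concavelike_on Y X (\<lambda>y x. - F x y)" by (simp add: convexlike_on_def)
  from concavelike_onE[OF this assms(2-)] obtain y where
    y: "y \<in> Y" "\<And>x. x \<in> X \<Longrightarrow> t * - F x y1 + (1 - t) * - F x y2 \<le> - F x y" by blast
  show thesis
  proof (rule that[OF y(1)])
    fix x assume "x \<in> X"
    from y(2)[OF this] show "F x y \<le> t * F x y1 + (1 - t) * F x y2" by (simp add: algebra_simps)
  qed
qed

lemma convexlike_on_subset:
  "convexlike_on X Y F \<Longrightarrow> X' \<subseteq> X \<Longrightarrow> convexlike_on X' Y F"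
  unfolding convexlike_on_def concavelike_on_def by (meson subsetD)

text \<open>An alternative of Gordan type for two functions. A point with \<open>g x > 0\<close>
  forces \<open>t\<close> to be at least \<open>g x / (g x - f x)\<close>, a point with
  \<open>f x > 0\<close> forces it to be at most \<open>- g x / (f x - g x)\<close>, and all other
  points accept any \<open>t\<close> between 0 and 1. The demands are compatible because each lower
  bound is at most each upper bound, which is where \<open>conc\<close> enters.\<close>

lemma separating_weight:
  fixes f g :: "'x \<Rightarrow> real"
  assumes conc: "\<And>x1 x2 t. \<lbrakk>x1 \<in> X; x2 \<in> X; 0 \<le> t; t \<le> 1\<rbrakk> \<Longrightarrow>
      \<exists>x\<in>X. t * f x1 + (1 - t) * f x2 \<le> f x \<and> t * g x1 + (1 - t) * g x2 \<le> g x"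
    and neg: "\<And>x. x \<in> X \<Longrightarrow> f x < 0 \<or> g x < 0"
  obtains t where "0 \<le> t" "t \<le> 1" "\<And>x. x \<in> X \<Longrightarrow> t * f x + (1 - t) * g x \<le> 0"
proof -
  \<comment> \<open>The lower bounds for \<open>t\<close>; the extra 0 makes the set nonempty and
    its supremum nonnegative.\<close>
  define L where "L = insert 0 ((\<lambda>x. g x / (g x - f x)) ` {x\<in>X. g x > 0})"
  define t where "t = Sup L"
  have L_le_1: "r \<le> 1" if "r \<in> L" for r
    using that neg by (force simp: L_def divide_simps)
  have bdd: "bdd_above L" using L_le_1 by (auto simp: bdd_above_def)
  have t0: "0 \<le> t" unfolding t_def by (rule cSup_upper[OF _ bdd]) (simp add: L_def)
  have t1: "t \<le> 1" unfolding t_def by (rule cSup_least) (use L_le_1 in \<open>auto simp: L_def\<close>)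
  have cross: "g x2 / (g x2 - f x2) \<le> - g x1 / (f x1 - g x1)"
    if x1: "x1 \<in> X" "f x1 > 0" and x2: "x2 \<in> X" "g x2 > 0" for x1 x2
  proof (rule ccontr)
    have f2: "f x2 < 0" and g1: "g x1 < 0" using neg[OF x1(1)] neg[OF x2(1)] x1 x2 by auto
    assume "\<not> ?thesis"
    hence "- g x1 * (g x2 - f x2) < g x2 * (f x1 - g x1)"
      using x1 x2 f2 g1 by (simp add: divide_simps)
    hence lt: "g x1 * f x2 < g x2 * f x1" by (simp add: algebra_simps)
    \<comment> \<open>The weight at which the mixture of \<open>f x1 > 0\<close> and
      \<open>f x2 < 0\<close> is exactly 0. By \<open>lt\<close> the same mixture of
      \<open>g\<close> is positive, so the dominating point violates \<open>neg\<close>.\<close>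
    define s where "s = - f x2 / (f x1 - f x2)"
    have s: "0 \<le> s" "s \<le> 1" using f2 x1 by (auto simp: s_def divide_simps)
    have s': "1 - s = f x1 / (f x1 - f x2)" using f2 x1 by (simp add: s_def divide_simps)
    obtain x where x: "x \<in> X" "s * f x1 + (1 - s) * f x2 \<le> f x" "s * g x1 + (1 - s) * g x2 \<le> g x"
      using conc[OF x1(1) x2(1) s] by blast
    have "s * f x1 + (1 - s) * f x2 = 0"
      unfolding s' using f2 x1 by (simp add: s_def divide_simps)
    moreover have "s * g x1 + (1 - s) * g x2 = (g x2 * f x1 - g x1 * f x2) / (f x1 - f x2)"
      unfolding s' by (simp add: s_def field_simps flip: add_divide_distrib diff_divide_distrib)
    moreover have "\<dots> > 0" using lt f2 x1 by (intro divide_pos_pos) auto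
    ultimately show False using x neg[OF x(1)] by auto
  qed
  have "t * f x + (1 - t) * g x \<le> 0" if x: "x \<in> X" for x
  proof (cases "g x > 0")
    case True
    hence "f x < 0" using neg[OF x] by auto
    have "g x / (g x - f x) \<le> t" unfolding t_def
      by (rule cSup_upper[OF _ bdd]) (use x True in \<open>auto simp: L_def\<close>)
    hence "g x \<le> t * (g x - f x)" using True \<open>f x < 0\<close> by (simp add: pos_divide_le_eq)
    thus ?thesis by (simp add: algebra_simps)
  next
    case g: False
    show ?thesis
    proof (cases "f x > 0")
      case True
      hence "g x < 0" using neg[OF x] by auto
      have "t \<le> - g x / (f x - g x)" unfolding t_def
      proof (rule cSup_least)
        show "r \<le> - g x / (f x - g x)" if "r \<in> L" for r
          using that cross[OF x True] True \<open>g x < 0\<close>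
          by (auto simp: L_def divide_nonpos_pos)
      qed (simp add: L_def)
      hence "t * (f x - g x) \<le> - g x" using True \<open>g x < 0\<close>
        by (subst (asm) pos_le_divide_eq) auto
      thus ?thesis by (simp add: algebra_simps)
    next
      case False
      thus ?thesis using g t0 t1
        by (intro add_nonpos_nonpos mult_nonneg_nonpos) auto
    qed
  qed
  with t0 t1 show thesis by (rule that)
qed

text \<open>Induction on the set of replies. The points where \<open>b\<close> is not good enough
  form a superlevel set, which is again concavelike, so the other replies can be replaced there by a
  single \<open>y0\<close>. At every point of \<open>X\<close> one of \<open>y0\<close> and
  \<open>b\<close> is then good enough, and \<open>separating_weight\<close> merges the two.\<close>

lemma minimax_finite:
  assumes "finite B" "B \<noteq> {}" "B \<subseteq> Y"
    and "concavelike_on X Y F" "convexlike_on X Y F"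
    and "\<And>x. x \<in> X \<Longrightarrow> \<exists>y\<in>B. F x y < v" "v < v'"
  shows "\<exists>y\<in>Y. \<forall>x\<in>X. F x y \<le> v'"
  using assms
proof (induction B arbitrary: X v v' rule: finite_ne_induct)
  case (singleton y)
  thus ?case by force
next
  case (insert b B)
  define X' where "X' = {x\<in>X. v \<le> F x b}"
  \<comment> \<open>Only half of the gap is given to the induction hypothesis: merging
    \<open>y0\<close> and \<open>b\<close> requires values strictly below \<open>v'\<close>.\<close>
  define m where "m = (v + v') / 2"
  have m: "v < m" "m < v'" using insert.prems by (auto simp: m_def)
  have b: "b \<in> Y" using insert.prems by auto
  have "\<exists>y\<in>Y. \<forall>x\<in>X'. F x y \<le> m"
  proof (rule insert.IH)
    show "concavelike_on X' Y F" unfolding concavelike_on_def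
    proof (intro ballI allI impI)
      fix x1 x2 and t :: real
      assume x: "x1 \<in> X'" "x2 \<in> X'" and t: "0 \<le> t \<and> t \<le> 1"
      obtain x where x': "x \<in> X" "\<And>y. y \<in> Y \<Longrightarrow> t * F x1 y + (1 - t) * F x2 y \<le> F x y"
        using concavelike_onE[OF insert.prems(2), of x1 x2 t] x t by (auto simp: X'_def)
      have "t * v + (1 - t) * v \<le> t * F x1 b + (1 - t) * F x2 b"
        using x t by (intro add_mono mult_left_mono) (auto simp: X'_def)
      also have "\<dots> \<le> F x b" using x'(2)[OF b] .
      finally have "v \<le> F x b" by (simp add: algebra_simps)
      thus "\<exists>x\<in>X'. \<forall>y\<in>Y. t * F x1 y + (1 - t) * F x2 y \<le> F x y"
        using x' by (auto simp: X'_def)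
    qed
    show "convexlike_on X' Y F"
      by (rule convexlike_on_subset[OF insert.prems(3)]) (auto simp: X'_def)
    show "\<exists>y\<in>B. F x y < v" if "x \<in> X'" for x
      using insert.prems(4)[of x] that by (auto simp: X'_def)
  qed (use insert.prems m in auto)
  then obtain y0 where y0: "y0 \<in> Y" "\<And>x. x \<in> X \<Longrightarrow> v \<le> F x b \<Longrightarrow> F x y0 \<le> m"
    by (auto simp: X'_def)
  have "\<exists>x\<in>X. t * (F x1 y0 - v') + (1 - t) * (F x2 y0 - v') \<le> F x y0 - v'
          \<and> t * (F x1 b - v') + (1 - t) * (F x2 b - v') \<le> F x b - v'"
    if h: "x1 \<in> X" "x2 \<in> X" "0 \<le> t" "t \<le> 1" for x1 x2 t
  proof -
    obtain x where "x \<in> X" "\<And>y. y \<in> Y \<Longrightarrow> t * F x1 y + (1 - t) * F x2 y \<le> F x y"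
      using concavelike_onE[OF insert.prems(2) h] by blast
    from this(1) this(2)[OF b] this(2)[OF y0(1)] show ?thesis
      by (intro bexI[of _ x]) (auto simp: algebra_simps)
  qed
  moreover have "F x y0 - v' < 0 \<or> F x b - v' < 0" if "x \<in> X" for x
    using y0(2)[OF that] m by force
  ultimately obtain t where t: "0 \<le> t" "t \<le> 1"
    "\<And>x. x \<in> X \<Longrightarrow> t * (F x y0 - v') + (1 - t) * (F x b - v') \<le> 0"
    by (rule separating_weight[of X "\<lambda>x. F x y0 - v'" "\<lambda>x. F x b - v'"]) auto
  obtain y where y: "y \<in> Y" "\<And>x. x \<in> X \<Longrightarrow> F x y \<le> t * F x y0 + (1 - t) * F x b"
    using convexlike_onE[OF insert.prems(3) y0(1) b t(1,2)] by blast
  have "F x y \<le> v'" if "x \<in> X" for x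
    using y(2)[OF that] t(3)[OF that] by (simp add: algebra_simps)
  with y(1) show ?case by blast
qed

text \<open>Compactness reduces the replies to finitely many. The strict gain \<open>v' < v\<close>
  is what later contradicts the choice of \<open>v\<close> as a supremum.\<close>

lemma minimax_strict:
  fixes X :: "'x::topological_space set"
  assumes X: "compact X" "X \<noteq> {}"
    and cont: "\<And>y. y \<in> Y \<Longrightarrow> continuous_on X (\<lambda>x. F x y)"
    and conv: "concavelike_on X Y F" "convexlike_on X Y F"
    and less: "\<And>x. x \<in> X \<Longrightarrow> \<exists>y\<in>Y. F x y < v"
  obtains v' y where "v' < v" "y \<in> Y" "\<And>x. x \<in> X \<Longrightarrow> F x y \<le> v'"
proof -
  have "\<exists>T. open T \<and> T \<inter> X = (\<lambda>x. F x y) -` {..<r} \<inter> X" if "y \<in> Y" for y r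
    using continuous_on_open_invariant[THEN iffD1, OF cont[OF that], rule_format, of "{..<r}"]
    by auto
  then obtain T where T: "\<And>y r. y \<in> Y \<Longrightarrow> open (T y r)"
      "\<And>y r. y \<in> Y \<Longrightarrow> T y r \<inter> X = (\<lambda>x. F x y) -` {..<r} \<inter> X" by metis
  \<comment> \<open>The cover is indexed by thresholds \<open>r < v\<close> as well as by replies,
    so that the largest threshold of a finite subcover is still below \<open>v\<close>.\<close>
  have "X \<subseteq> (\<Union>(y, r)\<in>Y \<times> {..<v}. T y r)"
  proof
    fix x assume x: "x \<in> X"
    then obtain y where y: "y \<in> Y" "F x y < v" using less by blast
    then obtain r where r: "F x y < r" "r < v" using dense by blast
    hence "x \<in> T y r" using T(2)[OF y(1), of r] x by auto
    thus "x \<in> (\<Union>(y, r)\<in>Y \<times> {..<v}. T y r)" using y r by blast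
  qed
  then obtain C where C: "C \<subseteq> Y \<times> {..<v}" "finite C" "X \<subseteq> (\<Union>(y, r)\<in>C. T y r)"
    by (rule compactE_image[OF X(1), of "Y \<times> {..<v}" "\<lambda>(y, r). T y r", rotated])
      (use T(1) in auto)
  have "C \<noteq> {}" using C(3) X(2) by auto
  define m where "m = Max (snd ` C)"
  have "m \<in> snd ` C" unfolding m_def using C \<open>C \<noteq> {}\<close> by (intro Max_in) auto
  hence "m < v" using C(1) by auto
  then obtain v' where v': "m < v'" "v' < v" using dense by blast
  have "\<exists>y\<in>Y. \<forall>x\<in>X. F x y \<le> v'"
  proof (rule minimax_finite[OF _ _ _ conv])
    show "finite (fst ` C)" "fst ` C \<noteq> {}" "fst ` C \<subseteq> Y" "m < v'"
      using C \<open>C \<noteq> {}\<close> v' by auto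
    show "\<exists>y\<in>fst ` C. F x y < m" if x: "x \<in> X" for x
    proof -
      obtain y r where yr: "(y, r) \<in> C" "x \<in> T y r" using C(3) x by auto
      hence "F x y < r" using T(2)[of y r] C(1) x by auto
      also have "r \<le> m" unfolding m_def using C yr by (intro Max_ge) force+
      finally show ?thesis using yr by force
    qed
  qed
  thus thesis using that v' by blast
qed

text \<open>With \<open>v\<close> the supremum of what the maximizer can guarantee, a failure of
  either half lets \<open>minimax_strict\<close> produce a strategy contradicting the choice of
  \<open>v\<close>: a reply capping every payoff below \<open>v\<close>, or a guarantee above
  \<open>v\<close>.\<close>

theorem minimax_compact_convexlike:
  fixes X :: "'x::topological_space set" and Y :: "'y::topological_space set"
  assumes X: "compact X" "X \<noteq> {}" and Y: "compact Y" "Y \<noteq> {}"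
    and contX: "\<And>y. y \<in> Y \<Longrightarrow> continuous_on X (\<lambda>x. F x y)"
    and contY: "\<And>x. x \<in> X \<Longrightarrow> continuous_on Y (F x)"
    and conv: "concavelike_on X Y F" "convexlike_on X Y F"
  shows "\<exists>v. (\<exists>x\<in>X. \<forall>y\<in>Y. v \<le> F x y) \<and> (\<exists>y\<in>Y. \<forall>x\<in>X. F x y \<le> v)"
proof -
  define V where "V = {v. \<exists>x\<in>X. \<forall>y\<in>Y. v \<le> F x y}"
  obtain y0 where y0: "y0 \<in> Y" using Y by auto
  obtain c where "\<And>x. x \<in> X \<Longrightarrow> F x y0 \<le> F c y0"
    using continuous_attains_sup[OF X contX[OF y0]] by auto
  hence "r \<le> F c y0" if "r \<in> V" for r
    using that y0 unfolding V_def by (blast intro: order.trans)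
  hence bdd: "bdd_above V" unfolding bdd_above_def by blast
  obtain x0 where x0: "x0 \<in> X" using X by auto
  obtain d where "\<And>y. y \<in> Y \<Longrightarrow> F x0 d \<le> F x0 y"
    using continuous_attains_inf[OF Y contY[OF x0]] by auto
  hence ne: "V \<noteq> {}" unfolding V_def using x0 by auto
  define v where "v = Sup V"
  have "\<exists>x\<in>X. \<forall>y\<in>Y. v \<le> F x y"
  proof (rule ccontr)
    assume "\<not> ?thesis"
    hence less: "\<And>x. x \<in> X \<Longrightarrow> \<exists>y\<in>Y. F x y < v" by force
    obtain v' y where "v' < v" "y \<in> Y" "\<And>x. x \<in> X \<Longrightarrow> F x y \<le> v'"
      using minimax_strict[OF X contX conv less] by blast
    hence "v \<le> v'" unfolding v_def by (intro cSup_least[OF ne]) (force simp: V_def)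
    with \<open>v' < v\<close> show False by simp
  qed
  moreover have "\<exists>y\<in>Y. \<forall>x\<in>X. F x y \<le> v"
  proof (rule ccontr)
    assume "\<not> ?thesis"
    hence less: "\<And>y. y \<in> Y \<Longrightarrow> \<exists>x\<in>X. - F x y < - v" by force
    \<comment> \<open>The second half is the strict lemma for the game with exchanged players,
      payoff \<open>- F\<close> and level \<open>- v\<close>.\<close>
    have "concavelike_on Y X (\<lambda>y x. - F x y)" "convexlike_on Y X (\<lambda>y x. - F x y)"
      using conv by (simp_all add: convexlike_on_def)
    moreover have "\<And>x. x \<in> X \<Longrightarrow> continuous_on Y (\<lambda>y. - F x y)"
      using contY by (intro continuous_on_minus)
    ultimately obtain v' x where "v' < - v" "x \<in> X" "\<And>y. y \<in> Y \<Longrightarrow> - F x y \<le> v'"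
      using minimax_strict[OF Y, of X "\<lambda>y x. - F x y" "- v"] less by blast
    hence "- v' \<in> V" unfolding V_def by force
    hence "- v' \<le> v" unfolding v_def by (rule cSup_upper[OF _ bdd])
    with \<open>v' < - v\<close> show False by simp
  qed
  ultimately show ?thesis by blast
qed

subsection \<open>Realization plans\<close>

text \<open>
  Both players are treated at once: \<open>own a b\<close> is the component of the action pair that the player
  chose, so that \<open>own\<close> is \<open>\<lambda>a b. a\<close> for player 1 and \<open>\<lambda>a b. b\<close> for player 2.
\<close>

primrec weight ::
  "('a \<Rightarrow> 'b \<Rightarrow> 'c) \<Rightarrow> ('a \<Rightarrow> 'b \<Rightarrow> 's \<Rightarrow> 's pmf) \<Rightarrow> ('s \<Rightarrow> real)
    \<Rightarrow> (('s, 'a, 'b) info \<Rightarrow> 'c \<Rightarrow> real) \<Rightarrow> ('s, 'a, 'b) info \<Rightarrow> real" where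
  "weight own K r x (Init s) = r s"
| "weight own K r x (Step I a b s) = pmf (K a b (cur_state I)) s * x I (own a b)"

lemma weight1_eq_weight: "weight1 P p R I = weight (\<lambda>a b. a) P (pmf p) R I"
  by (cases I) auto

text \<open>One player's factor in the probability of a history: own transitions and own choices,
  with the opponent's actions taken as given.\<close>

primrec reach ::
  "('a \<Rightarrow> 'b \<Rightarrow> 'c) \<Rightarrow> ('a \<Rightarrow> 'b \<Rightarrow> 's \<Rightarrow> 's pmf) \<Rightarrow> ('s \<Rightarrow> real)
    \<Rightarrow> (('s, 'a, 'b) info \<Rightarrow> 'c pmf) \<Rightarrow> ('s, 'a, 'b) info \<Rightarrow> real" where
  "reach own K r \<sigma> (Init s) = r s"
| "reach own K r \<sigma> (Step I a b s) =
     pmf (K a b (cur_state I)) s * (reach own K r \<sigma> I * pmf (\<sigma> I) (own a b))"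

definition plan_of where
  "plan_of own K r \<sigma> = (\<lambda>I c. reach own K r \<sigma> I * pmf (\<sigma> I) c)"

text \<open>The set \<open>A\<close> of admissible initial laws covers both roles: a singleton when
  nature draws the state, the whole simplex when the player chooses the law. The constraints are
  imposed at all stages, beyond any horizon, so that every coordinate is bounded.\<close>

definition plans ::
  "('a \<Rightarrow> 'b \<Rightarrow> 'c::finite) \<Rightarrow> ('a \<Rightarrow> 'b \<Rightarrow> 's \<Rightarrow> 's pmf) \<Rightarrow> ('s \<Rightarrow> real) set
    \<Rightarrow> (('s, 'a, 'b) info \<Rightarrow> 'c \<Rightarrow> real) set" where
  "plans own K A = {x. (\<forall>I c. 0 \<le> x I c) \<and>
     (\<exists>r\<in>A. \<forall>I. (\<Sum>c\<in>UNIV. x I c) = weight own K r x I)}"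

lemma plans_nonneg: "x \<in> plans own K A \<Longrightarrow> 0 \<le> x I c"
  by (simp add: plans_def)

lemma sum_pmf_UNIV: "(\<Sum>x\<in>UNIV. pmf p x) = 1" for p :: "'s::finite pmf"
  by (simp add: sum_pmf_eq_1)

lemma weight_plan_of: "weight own K r (plan_of own K r \<sigma>) I = reach own K r \<sigma> I"
  by (cases I) (auto simp: plan_of_def)

lemma sum_plan_of:
  "(\<Sum>c\<in>UNIV. plan_of own K r \<sigma> I c) = weight own K r (plan_of own K r \<sigma>) I"
  for own :: "'a \<Rightarrow> 'b \<Rightarrow> 'c::finite"
  unfolding weight_plan_of
  by (simp add: plan_of_def sum_pmf_UNIV flip: sum_distrib_left)

lemma reach_nonneg: "(\<And>s. 0 \<le> r s) \<Longrightarrow> 0 \<le> reach own K r \<sigma> I"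
  by (induction I) auto

lemma plan_of_nonneg: "(\<And>s. 0 \<le> r s) \<Longrightarrow> 0 \<le> plan_of own K r \<sigma> I c"
  by (simp add: plan_of_def reach_nonneg)

lemma plan_of_in_plans: "pmf p \<in> A \<Longrightarrow> plan_of own K (pmf p) \<sigma> \<in> plans own K A"
  unfolding plans_def by (auto intro!: plan_of_nonneg bexI[of _ "pmf p"] simp: sum_plan_of)

section \<open>Correspondence between realization plans and behavior strategies\<close>

lemma ex_pmf_of_finite:
  fixes f :: "'c::finite \<Rightarrow> real"
  assumes "\<And>c. 0 \<le> f c" "(\<Sum>c\<in>UNIV. f c) = 1"
  shows "\<exists>p. pmf p = f"
proof
  have "(\<integral>\<^sup>+x. ennreal (f x) \<partial>count_space UNIV) = 1"
    using assms by (simp add: nn_integral_count_space_finite sum_ennreal)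
  then show "pmf (embed_pmf f) = f" using assms(1) by (intro ext pmf_embed_pmf)
qed

text \<open>The hypotheses on \<open>x\<close> are stated separately for each \<open>I\<close>, so
  that the lemma also serves a solution of the linear program, which is constrained only up to stage
  \<open>n\<close>.\<close>

lemma induced_exists:
  fixes x :: "('s, 'a, 'b) info \<Rightarrow> 'c::finite \<Rightarrow> real"
  shows "\<exists>\<sigma>. \<forall>I. (\<forall>c. 0 \<le> x I c) \<longrightarrow> (\<Sum>c\<in>UNIV. x I c) = weight own K r x I \<longrightarrow>
      weight own K r x I \<noteq> 0 \<longrightarrow> (\<forall>c. pmf (\<sigma> I) c = x I c / weight own K r x I)"
proof -
  have "\<exists>p. (\<forall>c. 0 \<le> x I c) \<longrightarrow> (\<Sum>c\<in>UNIV. x I c) = weight own K r x I \<longrightarrow>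
      weight own K r x I \<noteq> 0 \<longrightarrow> (\<forall>c. pmf p c = x I c / weight own K r x I)" for I
  proof (cases "(\<forall>c. 0 \<le> x I c) \<and> (\<Sum>c\<in>UNIV. x I c) = weight own K r x I
      \<and> weight own K r x I \<noteq> 0")
    case True
    then have "0 \<le> weight own K r x I" by (metis sum_nonneg)
    with True have "\<exists>p. pmf p = (\<lambda>c. x I c / weight own K r x I)"
      by (intro ex_pmf_of_finite) (auto simp flip: sum_divide_distrib)
    then show ?thesis by metis
  qed auto
  then show ?thesis by (intro choice allI)
qed

text \<open>Going up the information states, the weight of \<open>x\<close> agrees with the reach
  probability of \<open>\<sigma>\<close>. Where it is nonzero the division is undone; where it is
  zero, nonnegative entries with sum zero vanish, so the arbitrary choice made by
  \<open>\<sigma>\<close> there has no effect.\<close>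

lemma induced_imp_plan_of:
  fixes x :: "('s, 'a, 'b) info \<Rightarrow> 'c::finite \<Rightarrow> real"
  assumes nonneg: "\<And>I c. stage I \<le> n \<Longrightarrow> 0 \<le> x I c"
    and sum: "\<And>I. stage I \<le> n \<Longrightarrow> (\<Sum>c\<in>UNIV. x I c) = weight own K r x I"
    and ind: "\<And>I c. stage I \<le> n \<Longrightarrow> weight own K r x I \<noteq> 0 \<Longrightarrow>
      pmf (\<sigma> I) c = x I c / weight own K r x I"
    and "stage I \<le> n"
  shows "x I c = plan_of own K r \<sigma> I c"
proof -
  have step: "x I c = plan_of own K r \<sigma> I c"
    if "stage I \<le> n" "weight own K r x I = reach own K r \<sigma> I" for I c
  proof (cases "weight own K r x I = 0")
    case True
    then have "x I c = 0" using sum[OF that(1)] nonneg[OF that(1)]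
      by (simp add: sum_nonneg_eq_0_iff)
    then show ?thesis using True that by (simp add: plan_of_def)
  next
    case False
    then show ?thesis using ind[OF that(1) False] that by (simp add: plan_of_def)
  qed
  from \<open>stage I \<le> n\<close> show ?thesis
  proof (induction I arbitrary: c)
    case (Init s)
    then show ?case by (intro step) auto
  next
    case (Step I a b s)
    then show ?case by (intro step) (auto simp: plan_of_def)
  qed
qed

lemma plansE:
  assumes "x \<in> plans own K A" "A \<subseteq> range pmf"
  obtains p \<sigma> where "pmf p \<in> A" "x = plan_of own K (pmf p) \<sigma>"
proof -
  from assms obtain p where p: "pmf p \<in> A" and nonneg: "\<And>I c. 0 \<le> x I c"
    and sum: "\<And>I. (\<Sum>c\<in>UNIV. x I c) = weight own K (pmf p) x I"
    unfolding plans_def by blast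
  obtain \<sigma> where ind: "\<And>I c. weight own K (pmf p) x I \<noteq> 0 \<Longrightarrow>
      pmf (\<sigma> I) c = x I c / weight own K (pmf p) x I"
    using induced_exists[of x own K "pmf p"] nonneg sum by blast
  have "x I c = plan_of own K (pmf p) \<sigma> I c" for I c
    by (rule induced_imp_plan_of[where n = "stage I"]) (use nonneg sum ind in auto)
  with p show thesis by (intro that) auto
qed

section \<open>Compactness and convexity of the sets of plans\<close>

lemma closed_range_pmf: "closed (range (pmf :: 's::finite pmf \<Rightarrow> 's \<Rightarrow> real))"
proof -
  have "f \<in> range pmf" if f: "\<forall>s. 0 \<le> f s" "(\<Sum>s\<in>UNIV. f s) = 1" for f :: "'s \<Rightarrow> real"
  proof -
    obtain p where "pmf p = f" using ex_pmf_of_finite[of f] f by blast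
    then show ?thesis by (metis rangeI)
  qed
  then have "range pmf = {f :: 's \<Rightarrow> real. (\<forall>s. 0 \<le> f s) \<and> (\<Sum>s\<in>UNIV. f s) = 1}"
    by (auto simp: sum_pmf_UNIV)
  moreover have "closed {f :: 's \<Rightarrow> real. \<forall>s. 0 \<le> f s}"
    by (intro closed_Collect_all closed_Collect_le continuous_on_const
        continuous_on_product_coordinates)
  moreover have "closed {f :: 's \<Rightarrow> real. (\<Sum>s\<in>UNIV. f s) = 1}"
    by (intro closed_Collect_eq continuous_on_const continuous_on_sum
        continuous_on_product_coordinates)
  ultimately show ?thesis by (simp add: closed_Collect_conj)
qed

lemma continuous_on_coordinate2: "continuous_on S (\<lambda>x. x i c)"
  for S :: "('i \<Rightarrow> 'c \<Rightarrow> real) set"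
proof -
  have "continuous_on S (\<lambda>x. x i)"
    by (rule continuous_on_product_then_coordinatewise[of S "\<lambda>x. x"]) (rule continuous_on_id)
  then show ?thesis by (rule continuous_on_product_then_coordinatewise)
qed

lemma compact_PiE_UNIV:
  fixes S :: "'i \<Rightarrow> 'b::topological_space set"
  assumes "\<And>i. compact (S i)"
  shows "compact (PiE UNIV S)"
proof -
  have "\<forall>i\<in>UNIV. compactin euclidean (S i)" using assms by simp
  then have "compactin (product_topology (\<lambda>_. euclidean) UNIV) (PiE UNIV S)"
    unfolding compactin_PiE by (rule disjI2)
  then show ?thesis unfolding euclidean_product_topology compactin_euclidean_iff .
qed

text \<open>A closed subset of a product of unit intervals, which is compact by Tychonoff. The upper
  bound 1 comes from representing a plan by a strategy: its entries are products of
  probabilities.\<close>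

lemma compact_plans:
  fixes own :: "'a \<Rightarrow> 'b \<Rightarrow> 'c::finite" and K :: "'a \<Rightarrow> 'b \<Rightarrow> 's::finite \<Rightarrow> 's pmf"
  assumes "closed A" "A \<subseteq> range pmf"
  shows "compact (plans own K A)"
proof -
  define B where "B = PiE (UNIV :: ('s, 'a, 'b) info set) (\<lambda>_. PiE (UNIV :: 'c set) (\<lambda>_. {0..1 :: real}))"
  have "compact B"
    unfolding B_def by (intro compact_PiE_UNIV) simp
  \<comment> \<open>The quantifier over the initial law would obstruct closedness. It is removed by
    reading the law off the plan as the row sums at the states \<open>Init s\<close>.\<close>
  have eq: "plans own K A = {x. (\<forall>I c. 0 \<le> x I c) \<and> (\<lambda>s. \<Sum>c\<in>UNIV. x (Init s) c) \<in> A \<and>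
      (\<forall>I a b s. (\<Sum>c\<in>UNIV. x (Step I a b s) c)
         = pmf (K a b (cur_state I)) s * x I (own a b))}" (is "_ = ?C")
  proof (intro set_eqI iffI)
    fix x assume "x \<in> plans own K A"
    then obtain r where r: "\<And>I c. 0 \<le> x I c" "r \<in> A" "\<And>I. (\<Sum>c\<in>UNIV. x I c) = weight own K r x I"
      by (auto simp: plans_def)
    then show "x \<in> ?C" by simp
  next
    fix x assume x: "x \<in> ?C"
    have "(\<Sum>c\<in>UNIV. x I c) = weight own K (\<lambda>s. \<Sum>c\<in>UNIV. x (Init s) c) x I" for I
      using x by (cases I) auto
    with x show "x \<in> plans own K A" unfolding plans_def by blast
  qed
  have "closed ((\<lambda>x s. \<Sum>c\<in>UNIV. x (Init s) c) -` A :: (('s, 'a, 'b) info \<Rightarrow> 'c \<Rightarrow> real) set)"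
    using assms(1) by (rule closed_vimage)
      (intro continuous_on_coordinatewise_then_product continuous_on_sum continuous_on_coordinate2)
  moreover have "closed {x :: ('s, 'a, 'b) info \<Rightarrow> 'c \<Rightarrow> real. \<forall>I c. 0 \<le> x I c}"
    by (intro closed_Collect_all closed_Collect_le continuous_on_const continuous_on_coordinate2)
  moreover have "closed {x. \<forall>I a b s. (\<Sum>c\<in>UNIV. x (Step I a b s) c)
      = pmf (K a b (cur_state I)) s * x I (own a b)}"
    by (intro closed_Collect_all closed_Collect_eq continuous_on_const continuous_on_mult
        continuous_on_sum continuous_on_coordinate2)
  ultimately have "closed (plans own K A)" unfolding eq by (simp add: closed_Collect_conj vimage_def)
  have le1: "x I c \<le> 1" if x: "x \<in> plans own K A" for x I c
  proof -
    obtain p \<sigma> where x: "x = plan_of own K (pmf p) \<sigma>" by (rule plansE[OF x assms(2)])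
    have nonneg: "0 \<le> reach own K (pmf p) \<sigma> I" for I
      by (rule reach_nonneg) (rule pmf_nonneg)
    have "reach own K (pmf p) \<sigma> I \<le> 1" for I
    proof (induction I)
      case (Step I a b s)
      then show ?case
        using nonneg[of I] by (simp add: mult_le_one pmf_le_1)
    qed (simp add: pmf_le_1)
    then show ?thesis unfolding x plan_of_def
      using nonneg[of I] by (simp add: mult_le_one pmf_le_1)
  qed
  have "plans own K A \<subseteq> B"
  proof
    fix x assume "x \<in> plans own K A"
    then show "x \<in> B" by (simp add: B_def PiE_iff plans_nonneg le1)
  qed
  then have "B \<inter> plans own K A = plans own K A" by blast
  with compact_Int_closed[OF \<open>compact B\<close> \<open>closed (plans own K A)\<close>] show ?thesis by argo
qed

lemma plans_convex:
  assumes "\<And>r r'. r \<in> A \<Longrightarrow> r' \<in> A \<Longrightarrow> (\<lambda>s. t * r s + (1 - t) * r' s) \<in> A"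
    and "x \<in> plans own K A" "y \<in> plans own K A" "0 \<le> t" "t \<le> 1"
  shows "(\<lambda>I c. t * x I c + (1 - t) * y I c) \<in> plans own K A"
proof -
  from assms(2,3) obtain r r' where r: "r \<in> A" "\<And>I. (\<Sum>c\<in>UNIV. x I c) = weight own K r x I"
    and r': "r' \<in> A" "\<And>I. (\<Sum>c\<in>UNIV. y I c) = weight own K r' y I"
    and nonneg: "\<And>I c. 0 \<le> x I c" "\<And>I c. 0 \<le> y I c"
    by (auto simp: plans_def)
  have "(\<Sum>c\<in>UNIV. t * x I c + (1 - t) * y I c)
      = weight own K (\<lambda>s. t * r s + (1 - t) * r' s) (\<lambda>I c. t * x I c + (1 - t) * y I c) I" for I
  proof -
    have "(\<Sum>c\<in>UNIV. t * x I c + (1 - t) * y I c)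
        = t * weight own K r x I + (1 - t) * weight own K r' y I"
      by (simp add: sum.distrib flip: sum_distrib_left r(2) r'(2))
    also have "\<dots> = weight own K (\<lambda>s. t * r s + (1 - t) * r' s)
        (\<lambda>I c. t * x I c + (1 - t) * y I c) I"
      by (cases I) (simp_all add: algebra_simps)
    finally show ?thesis .
  qed
  then show ?thesis unfolding plans_def
    using assms(1)[OF r(1) r'(1)] nonneg assms(4,5) by auto
qed

subsection \<open>The payoff as a bilinear function of realization plans\<close>

abbreviation plan1 where "plan1 P p \<sigma> \<equiv> plan_of (\<lambda>a b. a) P (pmf p) \<sigma>"
abbreviation plan2 where "plan2 Q q \<tau> \<equiv> plan_of (\<lambda>a b. b) Q (pmf q) \<tau>"

section \<open>Information states, full histories and sums over them\<close>

lemma stage_eq_length: "stage I = Suc (length (actions I))"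
  by (induction I) auto

lemma stage_neq_0 [simp]: "stage I \<noteq> 0"
  by (simp add: stage_eq_length)

lemma stage_map_info [simp]: "stage (map_info f H) = stage H"
  by (induction H) auto

lemma actions_map_info [simp]: "actions (map_info f H) = actions H"
  by (induction H) auto

lemma cur_state_map_info [simp]: "cur_state (map_info f H) = f (cur_state H)"
  by (cases H) auto

lemma stage_Suc_0: "{J :: ('s, 'a, 'b) info. stage J = Suc 0} = range Init"
proof (intro set_eqI iffI)
  fix J :: "('s, 'a, 'b) info"
  assume "J \<in> {J. stage J = Suc 0}"
  then show "J \<in> range Init" by (cases J) auto
qed auto

lemma stage_Suc_Suc:
  "{J :: ('s, 'a, 'b) info. stage J = Suc (Suc t)}
     = (\<lambda>(J, a, b, s). Step J a b s) ` ({J. stage J = Suc t} \<times> UNIV \<times> UNIV \<times> UNIV)"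
proof (intro set_eqI iffI)
  fix J :: "('s, 'a, 'b) info"
  assume "J \<in> {J. stage J = Suc (Suc t)}"
  then obtain J' a b s where "J = Step J' a b s" "stage J' = Suc t" by (cases J) auto
  then show "J \<in> (\<lambda>(J, a, b, s). Step J a b s) ` ({J. stage J = Suc t} \<times> UNIV \<times> UNIV \<times> UNIV)"
    by (intro image_eqI[of _ _ "(J', a, b, s)"]) auto
qed auto

lemma finite_stage: "finite {J :: ('s::finite, 'a::finite, 'b::finite) info. stage J = Suc t}"
  by (induction t) (simp_all add: stage_Suc_0 stage_Suc_Suc)

lemma sum_stage_Suc_0: "(\<Sum>J | stage J = Suc 0. f J) = (\<Sum>s\<in>UNIV. f (Init s))"
  unfolding stage_Suc_0 by (subst sum.reindex) (auto simp: inj_on_def)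

lemma sum_stage_Suc_Suc:
  fixes f :: "('s::finite, 'a::finite, 'b::finite) info \<Rightarrow> 'c::comm_monoid_add"
  shows "(\<Sum>J | stage J = Suc (Suc t). f J)
    = (\<Sum>J | stage J = Suc t. \<Sum>a\<in>UNIV. \<Sum>b\<in>UNIV. \<Sum>s\<in>UNIV. f (Step J a b s))"
proof -
  have "(\<Sum>J | stage J = Suc (Suc t). f J)
      = (\<Sum>(J, a, b, s) \<in> {J. stage J = Suc t} \<times> UNIV \<times> UNIV \<times> UNIV. f (Step J a b s))"
    unfolding stage_Suc_Suc by (subst sum.reindex) (auto simp: inj_on_def case_prod_unfold)
  then show ?thesis by (simp add: sum.cartesian_product case_prod_unfold)
qed

lemma history_eqI:
  "map_info fst H = map_info fst H' \<Longrightarrow> map_info snd H = map_info snd H' \<Longrightarrow> H = H'"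
proof (induction H arbitrary: H')
  case (Init s)
  then show ?case by (cases H') (auto intro: prod_eqI)
next
  case (Step H a b s)
  then show ?case by (cases H') (auto intro: prod_eqI)
qed

lemma history_exists:
  "actions I = actions J \<Longrightarrow> \<exists>H. map_info fst H = I \<and> map_info snd H = J"
proof (induction I arbitrary: J)
  case (Init k)
  then obtain l where "J = Init l" by (cases J) auto
  then have "map_info fst (Init (k, l)) = Init k \<and> map_info snd (Init (k, l)) = J" by simp
  then show ?case by blast
next
  case (Step I a b k)
  then obtain J' l where J: "J = Step J' a b l" and "actions I = actions J'" by (cases J) auto
  then obtain H where "map_info fst H = I \<and> map_info snd H = J'" using Step.IH by blast
  then have "map_info fst (Step H a b (k, l)) = Step I a b k \<and>
      map_info snd (Step H a b (k, l)) = J" using J by simp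
  then show ?case by blast
qed

text \<open>A history is the same as a pair of information states with equal action lists. This
  turns sums over histories into the sums with \<open>actions I = actions J\<close> of the linear
  program.\<close>

lemma sum_histories:
  fixes f :: "('k::finite, 'a::finite, 'b::finite) info \<Rightarrow> ('l::finite, 'a, 'b) info
    \<Rightarrow> 'c::comm_monoid_add"
  shows "(\<Sum>H | stage H = Suc t. f (map_info fst H) (map_info snd H))
    = (\<Sum>J | stage J = Suc t. \<Sum>I | actions I = actions J. f I J)"
proof -
  have "bij_betw (\<lambda>H :: ('k \<times> 'l, 'a, 'b) info. (map_info snd H, map_info fst H))
      {H. stage H = Suc t} (SIGMA J:{J. stage J = Suc t}. {I. actions I = actions J})"
    unfolding bij_betw_def
  proof
    show "inj_on (\<lambda>H :: ('k \<times> 'l, 'a, 'b) info. (map_info snd H, map_info fst H))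
        {H. stage H = Suc t}"
      by (auto simp: inj_on_def intro: history_eqI)
    show "(\<lambda>H :: ('k \<times> 'l, 'a, 'b) info. (map_info snd H, map_info fst H)) ` {H. stage H = Suc t}
        = (SIGMA J:{J. stage J = Suc t}. {I. actions I = actions J})"
    proof (intro set_eqI iffI)
      fix x :: "('l, 'a, 'b) info \<times> ('k, 'a, 'b) info"
      assume x: "x \<in> (SIGMA J:{J. stage J = Suc t}. {I. actions I = actions J})"
      then obtain H where H: "map_info fst H = snd x" "map_info snd H = fst x"
        using history_exists[of "snd x" "fst x"] by auto
      then have "stage H = Suc t" using x stage_map_info[of snd H] by auto
      with H show "x \<in> (\<lambda>H. (map_info snd H, map_info fst H)) ` {H. stage H = Suc t}"
        by (intro image_eqI[of _ _ H]) auto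
    qed auto
  qed
  from sum.reindex_bij_betw[OF this, of "\<lambda>(J, I). f I J"] show ?thesis
    by (simp add: sum.Sigma finite_stage finite_same_actions)
qed

text \<open>Given the actions, the two state processes and the two players' randomizations are
  independent, so the law splits into one factor per player.\<close>

lemma pmf_play:
  fixes P :: "'a \<Rightarrow> 'b \<Rightarrow> 'k \<Rightarrow> 'k pmf" and Q :: "'a \<Rightarrow> 'b \<Rightarrow> 'l \<Rightarrow> 'l pmf"
  shows "pmf (play P Q p q \<sigma> \<tau> t) H =
     (if stage H = Suc t
      then reach (\<lambda>a b. a) P (pmf p) \<sigma> (map_info fst H)
           * reach (\<lambda>a b. b) Q (pmf q) \<tau> (map_info snd H)
      else 0)"
proof (induction t arbitrary: H)
  case 0
  show ?case
  proof (cases H)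
    case (Init s)
    have "pmf (map_pmf Init (pair_pmf p q)) (Init s) = pmf (pair_pmf p q) s"
      by (intro pmf_map_inj') (auto simp: inj_def)
    then show ?thesis using Init by (cases s) (simp add: pmf_pair)
  next
    case (Step H' a b s)
    then show ?thesis by (auto simp: pmf_eq_0_set_pmf)
  qed
next
  case (Suc t)
  show ?case
  proof (cases H)
    case (Init s)
    then show ?thesis by (auto simp: pmf_eq_0_set_pmf)
  next
    case (Step H' a b s)
    define M where "M H = pair_pmf (\<sigma> (map_info fst H)) (\<tau> (map_info snd H))" for H
    define N where "N H a b = pair_pmf (P a b (fst (cur_state H))) (Q a b (snd (cur_state H)))"
      for H :: "('k \<times> 'l, 'a, 'b) info" and a b
    have play: "play P Q p q \<sigma> \<tau> (Suc t) = bind_pmf (play P Q p q \<sigma> \<tau> t)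
        (\<lambda>H. bind_pmf (M H) (\<lambda>(a, b). map_pmf (Step H a b) (N H a b)))"
      by (simp add: M_def N_def)
    have zero: "pmf (map_pmf (Step H'' a' b') (N H'' a' b')) H = 0"
      if "H'' \<noteq> H' \<or> (a', b') \<noteq> (a, b)" for H'' a' b'
      using that Step by (auto simp: pmf_eq_0_set_pmf)
    \<comment> \<open>A history that is a \<open>Step\<close> has exactly one predecessor and one
      last action pair, so both integrals reduce to a single point.\<close>
    have "pmf (bind_pmf (M H') (\<lambda>(a, b). map_pmf (Step H' a b) (N H' a b))) H
        = pmf (map_pmf (Step H' a b) (N H' a b)) H * pmf (M H') (a, b)"
      unfolding pmf_bind
      by (subst integral_measure_pmf_real[where A = "{(a, b)}"]) (use zero in \<open>force+\<close>)
    also have "pmf (map_pmf (Step H' a b) (N H' a b)) H = pmf (N H' a b) s"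
      unfolding Step by (intro pmf_map_inj') (auto simp: inj_def)
    finally have inner: "pmf (bind_pmf (M H') (\<lambda>(a, b). map_pmf (Step H' a b) (N H' a b))) H
        = pmf (N H' a b) s * pmf (M H') (a, b)" .
    have outer: "pmf (bind_pmf (M H'') (\<lambda>(a, b). map_pmf (Step H'' a b) (N H'' a b))) H = 0"
      if "H'' \<noteq> H'" for H''
      using that Step by (auto simp: pmf_eq_0_set_pmf)
    have "pmf (play P Q p q \<sigma> \<tau> (Suc t)) H
        = pmf (N H' a b) s * pmf (M H') (a, b) * pmf (play P Q p q \<sigma> \<tau> t) H'"
      unfolding play pmf_bind[of "play P Q p q \<sigma> \<tau> t"]
      by (subst integral_measure_pmf_real[where A = "{H'}"]) (use outer inner in auto)
    then show ?thesis unfolding Suc.IH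
      by (cases s) (simp add: Step N_def M_def pmf_pair)
  qed
qed

text \<open>The coefficient of \<open>S J b\<close> in the payoff when the plan \<open>R\<close> is
  held fixed.\<close>

definition reward ::
  "('k::finite \<Rightarrow> 'l \<Rightarrow> 'a::finite \<Rightarrow> 'b \<Rightarrow> real) \<Rightarrow> real
    \<Rightarrow> (('k, 'a, 'b) info \<Rightarrow> 'a \<Rightarrow> real) \<Rightarrow> ('l, 'a, 'b) info \<Rightarrow> 'b \<Rightarrow> real" where
  "reward G lam R J b = (\<Sum>I | actions I = actions J. \<Sum>a\<in>UNIV.
     R I a * lam ^ (stage J - 1) * G (cur_state I) (cur_state J) a b)"

text \<open>The initial law of player 2 is recovered as the row sum of \<open>S\<close> at
  \<open>Init l\<close>. This makes the payoff a function of the plans alone, linear in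
  \<open>S\<close>.\<close>

definition plan_payoff ::
  "('k::finite \<Rightarrow> 'l::finite \<Rightarrow> 'a::finite \<Rightarrow> 'b::finite \<Rightarrow> real) \<Rightarrow> real \<Rightarrow> ('l \<Rightarrow> real) \<Rightarrow> nat
    \<Rightarrow> (('k, 'a, 'b) info \<Rightarrow> 'a \<Rightarrow> real) \<Rightarrow> (('l, 'a, 'b) info \<Rightarrow> 'b \<Rightarrow> real) \<Rightarrow> real" where
  "plan_payoff G lam \<nu> n R S = (\<Sum>l\<in>UNIV. \<nu> l * (\<Sum>b\<in>UNIV. S (Init l) b))
     + (\<Sum>t<n. \<Sum>J | stage J = Suc t. \<Sum>b\<in>UNIV. S J b * reward G lam R J b)"

text \<open>By \<open>pmf_play\<close> the expectation is a finite sum over the histories of stage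
  \<open>n + 1\<close>. Later choices and transitions have total mass 1 and sum out, so each stage
  payoff is weighted by histories of its own stage; \<open>sum_histories\<close> then regroups these
  by what player 2 knows.\<close>

lemma dual2_payoff_eq_plan_payoff:
  fixes G :: "'k::finite \<Rightarrow> 'l::finite \<Rightarrow> 'a::finite \<Rightarrow> 'b::finite \<Rightarrow> real"
  shows "dual2_payoff G P Q n lam p \<nu> \<sigma> (q, \<tau>)
    = plan_payoff G lam \<nu> n (plan1 P p \<sigma>) (plan2 Q q \<tau>)"
proof -
  define w where "w H = reach (\<lambda>a b. a) P (pmf p) \<sigma> (map_info fst H)
      * reach (\<lambda>a b. b) Q (pmf q) \<tau> (map_info snd H)" for H
  have step: "(\<Sum>s\<in>UNIV. w (Step H a b s))
      = w H * (pmf (\<sigma> (map_info fst H)) a * pmf (\<tau> (map_info snd H)) b)" for H a b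
  proof -
    have "(\<Sum>s\<in>UNIV. w (Step H a b s))
        = (\<Sum>(k, l)\<in>UNIV \<times> UNIV. pmf (P a b (fst (cur_state H))) k * pmf (Q a b (snd (cur_state H))) l
            * (w H * (pmf (\<sigma> (map_info fst H)) a * pmf (\<tau> (map_info snd H)) b)))"
      by (simp add: w_def case_prod_unfold algebra_simps)
    also have "\<dots> = (\<Sum>k\<in>UNIV. pmf (P a b (fst (cur_state H))) k)
        * (\<Sum>l\<in>UNIV. pmf (Q a b (snd (cur_state H))) l)
        * (w H * (pmf (\<sigma> (map_info fst H)) a * pmf (\<tau> (map_info snd H)) b))"
      by (subst sum_product)
        (simp add: sum_distrib_right sum.cartesian_product case_prod_unfold)
    finally show ?thesis by (simp add: sum_pmf_UNIV)
  qed
  have actions: "(\<Sum>a\<in>UNIV. \<Sum>b\<in>UNIV. pmf (\<sigma> (map_info fst H)) a * pmf (\<tau> (map_info snd H)) b) = 1"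
    for H :: "('k \<times> 'l, 'a, 'b) info"
    by (simp add: sum_pmf_UNIV flip: sum_product)
  \<comment> \<open>Summing out the last stage: a quantity that grows by \<open>h\<close> with the
    last action pair splits into its previous total and the expected increment. The initial payment
    uses \<open>h = 0\<close>, the discounted sum uses the stage payoff.\<close>
  have marginal: "(\<Sum>H | stage H = Suc (Suc t). w H * g H)
      = (\<Sum>H | stage H = Suc t. w H * g' H)
        + (\<Sum>H | stage H = Suc t. \<Sum>a\<in>UNIV. \<Sum>b\<in>UNIV. w H *
            (pmf (\<sigma> (map_info fst H)) a * pmf (\<tau> (map_info snd H)) b) * h H a b)"
    if g: "\<And>H a b s. stage H = Suc t \<Longrightarrow> g (Step H a b s) = g' H + h H a b" for g g' h t
  proof -
    have "(\<Sum>a\<in>UNIV. \<Sum>b\<in>UNIV. \<Sum>s\<in>UNIV. w (Step H a b s) * g (Step H a b s))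
        = w H * g' H + (\<Sum>a\<in>UNIV. \<Sum>b\<in>UNIV. w H *
            (pmf (\<sigma> (map_info fst H)) a * pmf (\<tau> (map_info snd H)) b) * h H a b)"
      if H: "stage H = Suc t" for H
    proof -
      have "(\<Sum>a\<in>UNIV. \<Sum>b\<in>UNIV. \<Sum>s\<in>UNIV. w (Step H a b s) * g (Step H a b s))
          = (\<Sum>a\<in>UNIV. \<Sum>b\<in>UNIV. w H *
              (pmf (\<sigma> (map_info fst H)) a * pmf (\<tau> (map_info snd H)) b) * (g' H + h H a b))"
        by (simp add: g[OF H] step flip: sum_distrib_right)
      also have "\<dots> = w H * g' H * (\<Sum>a\<in>UNIV. \<Sum>b\<in>UNIV.
            pmf (\<sigma> (map_info fst H)) a * pmf (\<tau> (map_info snd H)) b)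
          + (\<Sum>a\<in>UNIV. \<Sum>b\<in>UNIV. w H *
            (pmf (\<sigma> (map_info fst H)) a * pmf (\<tau> (map_info snd H)) b) * h H a b)"
        by (simp add: distrib_left sum.distrib sum_distrib_left mult_ac)
      finally show ?thesis by (simp add: actions)
    qed
    then show ?thesis by (simp add: sum_stage_Suc_Suc sum.distrib)
  qed
  have init: "(\<Sum>H | stage H = Suc t. w H * \<nu> (snd (first_state H))) = (\<Sum>l\<in>UNIV. \<nu> l * pmf q l)" for t
  proof (induction t)
    case 0
    have "(\<Sum>H | stage H = Suc 0. w H * \<nu> (snd (first_state H)))
        = (\<Sum>(k, l)\<in>UNIV \<times> UNIV. pmf p k * (\<nu> l * pmf q l))"
      unfolding sum_stage_Suc_0 by (simp add: w_def case_prod_unfold mult_ac)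
    also have "\<dots> = (\<Sum>k\<in>UNIV. pmf p k) * (\<Sum>l\<in>UNIV. \<nu> l * pmf q l)"
      unfolding sum_product sum.cartesian_product ..
    finally show ?case by (simp add: sum_pmf_UNIV)
  next
    case (Suc t)
    show ?case using marginal[of t "\<lambda>H. \<nu> (snd (first_state H))" "\<lambda>H. \<nu> (snd (first_state H))"
        "\<lambda>_ _ _. 0"] Suc by simp
  qed
  have total: "(\<Sum>H | stage H = Suc n. w H * total_payoff G lam H)
      = (\<Sum>t<n. \<Sum>J | stage J = Suc t. \<Sum>b\<in>UNIV.
          plan2 Q q \<tau> J b * reward G lam (plan1 P p \<sigma>) J b)" for n
  proof (induction n)
    case 0
    show ?case unfolding sum_stage_Suc_0 by simp
  next
    case (Suc n)
    have "(\<Sum>H | stage H = Suc n. \<Sum>a\<in>UNIV. \<Sum>b\<in>UNIV. w H *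
            (pmf (\<sigma> (map_info fst H)) a * pmf (\<tau> (map_info snd H)) b) *
            (lam ^ (stage H - 1) * G (fst (cur_state H)) (snd (cur_state H)) a b))
        = (\<Sum>H | stage H = Suc n. \<Sum>a\<in>UNIV. \<Sum>b\<in>UNIV.
            plan1 P p \<sigma> (map_info fst H) a * plan2 Q q \<tau> (map_info snd H) b
            * (lam ^ (stage (map_info snd H) - 1)
               * G (cur_state (map_info fst H)) (cur_state (map_info snd H)) a b))"
      by (simp add: w_def plan_of_def mult_ac)
    also have "\<dots> = (\<Sum>J | stage J = Suc n. \<Sum>I | actions I = actions J. \<Sum>a\<in>UNIV. \<Sum>b\<in>UNIV.
            plan1 P p \<sigma> I a * plan2 Q q \<tau> J b
            * (lam ^ (stage J - 1) * G (cur_state I) (cur_state J) a b))"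
      by (rule sum_histories)
    also have "\<dots> = (\<Sum>J | stage J = Suc n. \<Sum>I | actions I = actions J. \<Sum>b\<in>UNIV. \<Sum>a\<in>UNIV.
            plan1 P p \<sigma> I a * plan2 Q q \<tau> J b
            * (lam ^ (stage J - 1) * G (cur_state I) (cur_state J) a b))"
      by (intro sum.cong refl sum.swap)
    also have "\<dots> = (\<Sum>J | stage J = Suc n. \<Sum>b\<in>UNIV. \<Sum>I | actions I = actions J. \<Sum>a\<in>UNIV.
            plan1 P p \<sigma> I a * plan2 Q q \<tau> J b
            * (lam ^ (stage J - 1) * G (cur_state I) (cur_state J) a b))"
      by (intro sum.cong refl sum.swap)
    also have "\<dots> = (\<Sum>J | stage J = Suc n. \<Sum>b\<in>UNIV.
          plan2 Q q \<tau> J b * reward G lam (plan1 P p \<sigma>) J b)"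
      unfolding reward_def sum_distrib_left by (simp add: mult_ac)
    finally show ?case
      using marginal[of n "total_payoff G lam" "total_payoff G lam"
          "\<lambda>H a b. lam ^ (stage H - 1) * G (fst (cur_state H)) (snd (cur_state H)) a b"] Suc.IH
      by simp
  qed
  have "dual2_payoff G P Q n lam p \<nu> \<sigma> (q, \<tau>)
      = (\<Sum>H | stage H = Suc n. (\<nu> (snd (first_state H)) + total_payoff G lam H)
          * pmf (play P Q p q \<sigma> \<tau> n) H)"
    unfolding dual2_payoff_def prod.case
    by (rule integral_measure_pmf_real) (auto simp: finite_stage set_pmf_iff pmf_play split: if_splits)
  also have "\<dots> = (\<Sum>H | stage H = Suc n. w H * \<nu> (snd (first_state H)))
      + (\<Sum>H | stage H = Suc n. w H * total_payoff G lam H)"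
    by (simp add: pmf_play w_def distrib_right mult.commute sum.distrib)
  finally show ?thesis unfolding plan_payoff_def init total
    by (simp add: plan_of_def sum_pmf_UNIV flip: sum_distrib_left)
qed

section \<open>Dependence of the payoff on plans, and existence of the value\<close>

lemma reward_cong:
  assumes "\<And>I a. stage I = stage J \<Longrightarrow> R I a = R' I a"
  shows "reward G lam R J b = reward G lam R' J b"
  unfolding reward_def by (intro sum.cong refl) (simp add: assms stage_eq_length)

lemma plan_payoff_cong:
  assumes "\<And>I a. stage I \<le> n \<Longrightarrow> R I a = R' I a"
  shows "plan_payoff G lam \<nu> n R S = plan_payoff G lam \<nu> n R' S"
proof -
  have "reward G lam R J b = reward G lam R' J b" if "t < n" "stage J = Suc t" for J b t
    using that by (intro reward_cong assms) auto
  then show ?thesis unfolding plan_payoff_def by (auto intro!: sum.cong)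
qed

lemma reward_affine:
  "reward G lam (\<lambda>I a. t * R I a + (1 - t) * R' I a) J b
    = t * reward G lam R J b + (1 - t) * reward G lam R' J b"
  unfolding reward_def sum_distrib_left sum.distrib[symmetric]
  by (intro sum.cong refl) (simp add: algebra_simps)

lemma plan_payoff_affine1:
  "plan_payoff G lam \<nu> n (\<lambda>I a. t * R I a + (1 - t) * R' I a) S
    = t * plan_payoff G lam \<nu> n R S + (1 - t) * plan_payoff G lam \<nu> n R' S"
proof -
  have "(\<Sum>s<n. \<Sum>J | stage J = Suc s. \<Sum>b\<in>UNIV.
        S J b * (t * reward G lam R J b + (1 - t) * reward G lam R' J b))
      = t * (\<Sum>s<n. \<Sum>J | stage J = Suc s. \<Sum>b\<in>UNIV. S J b * reward G lam R J b)
        + (1 - t) * (\<Sum>s<n. \<Sum>J | stage J = Suc s. \<Sum>b\<in>UNIV. S J b * reward G lam R' J b)"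
    unfolding sum_distrib_left sum.distrib[symmetric]
    by (intro sum.cong refl) (simp add: algebra_simps)
  then show ?thesis unfolding plan_payoff_def reward_affine by (simp add: algebra_simps)
qed

lemma plan_payoff_affine2:
  "plan_payoff G lam \<nu> n R (\<lambda>J b. t * S J b + (1 - t) * S' J b)
    = t * plan_payoff G lam \<nu> n R S + (1 - t) * plan_payoff G lam \<nu> n R S'"
proof -
  have "(\<Sum>s<n. \<Sum>J | stage J = Suc s. \<Sum>b\<in>UNIV.
        (t * S J b + (1 - t) * S' J b) * reward G lam R J b)
      = t * (\<Sum>s<n. \<Sum>J | stage J = Suc s. \<Sum>b\<in>UNIV. S J b * reward G lam R J b)
        + (1 - t) * (\<Sum>s<n. \<Sum>J | stage J = Suc s. \<Sum>b\<in>UNIV. S' J b * reward G lam R J b)"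
    unfolding sum_distrib_left sum.distrib[symmetric]
    by (intro sum.cong refl) (simp add: algebra_simps)
  moreover have "(\<Sum>l\<in>UNIV. \<nu> l * (\<Sum>b\<in>UNIV. t * S (Init l) b + (1 - t) * S' (Init l) b))
      = t * (\<Sum>l\<in>UNIV. \<nu> l * (\<Sum>b\<in>UNIV. S (Init l) b))
        + (1 - t) * (\<Sum>l\<in>UNIV. \<nu> l * (\<Sum>b\<in>UNIV. S' (Init l) b))"
    unfolding sum_distrib_left sum.distrib[symmetric]
    by (intro sum.cong refl) (simp add: algebra_simps)
  ultimately show ?thesis unfolding plan_payoff_def by (simp add: algebra_simps)
qed

lemma continuous_on_plan_payoff1: "continuous_on X (\<lambda>R. plan_payoff G lam \<nu> n R S)"
  unfolding plan_payoff_def reward_def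
  by (intro continuous_on_add continuous_on_sum continuous_on_mult continuous_on_const
      continuous_on_coordinate2)

lemma continuous_on_plan_payoff2: "continuous_on Y (\<lambda>S. plan_payoff G lam \<nu> n R S)"
  unfolding plan_payoff_def
  by (intro continuous_on_add continuous_on_sum continuous_on_mult continuous_on_const
      continuous_on_coordinate2)

lemma dual2_game_value_exists:
  fixes G :: "'k::finite \<Rightarrow> 'l::finite \<Rightarrow> 'a::finite \<Rightarrow> 'b::finite \<Rightarrow> real"
    and P :: "'a \<Rightarrow> 'b \<Rightarrow> 'k \<Rightarrow> 'k pmf" and Q :: "'a \<Rightarrow> 'b \<Rightarrow> 'l \<Rightarrow> 'l pmf"
  shows "\<exists>v. is_game_value (dual2_payoff G P Q n lam p \<nu>) v"
proof -
  \<comment> \<open>Nature fixes the law of player 1's state, whereas player 2 may choose any law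
    for its own.\<close>
  define X where "X = plans (\<lambda>a b. a) P {pmf p}"
  define Y where "Y = plans (\<lambda>a b. b) Q (range pmf)"
  have plan1: "plan1 P p \<sigma> \<in> X" for \<sigma> unfolding X_def by (intro plan_of_in_plans) simp
  have plan2: "plan2 Q q \<tau> \<in> Y" for q \<tau> unfolding Y_def by (intro plan_of_in_plans) simp
  have convex_X: "(\<lambda>I a. t * R I a + (1 - t) * R' I a) \<in> X"
    if "R \<in> X" "R' \<in> X" "0 \<le> t" "t \<le> 1" for R R' t
    using that unfolding X_def by (intro plans_convex) (auto simp: algebra_simps)
  have convex_pmf: "(\<lambda>s. t * r s + (1 - t) * r' s) \<in> range (pmf :: 'l pmf \<Rightarrow> 'l \<Rightarrow> real)"
    if r: "r \<in> range pmf" "r' \<in> range pmf" and t: "0 \<le> t" "t \<le> 1" for r r' t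
  proof -
    obtain q q' where q: "r = pmf q" "r' = pmf q'" using r by blast
    have "\<exists>q''. pmf q'' = (\<lambda>s. t * r s + (1 - t) * r' s)"
      using t by (intro ex_pmf_of_finite)
        (simp_all add: q sum.distrib sum_pmf_UNIV flip: sum_distrib_left)
    then show ?thesis by (metis rangeI)
  qed
  have convex_Y: "(\<lambda>J b. t * S J b + (1 - t) * S' J b) \<in> Y"
    if "S \<in> Y" "S' \<in> Y" "0 \<le> t" "t \<le> 1" for S S' t
    using that unfolding Y_def by (intro plans_convex convex_pmf)
  have conc: "concavelike_on X Y (plan_payoff G lam \<nu> n)"
    unfolding concavelike_on_def
  proof (intro ballI allI impI, elim conjE)
    fix R R' and t :: real
    assume "R \<in> X" "R' \<in> X" "0 \<le> t" "t \<le> 1"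
    then show "\<exists>R''\<in>X. \<forall>S\<in>Y. t * plan_payoff G lam \<nu> n R S + (1 - t) * plan_payoff G lam \<nu> n R' S
        \<le> plan_payoff G lam \<nu> n R'' S"
      by (intro bexI[OF _ convex_X[of R R' t]]) (auto simp: plan_payoff_affine1)
  qed
  have conv: "convexlike_on X Y (plan_payoff G lam \<nu> n)"
    unfolding convexlike_on_def concavelike_on_def
  proof (intro ballI allI impI, elim conjE)
    fix S S' and t :: real
    assume "S \<in> Y" "S' \<in> Y" "0 \<le> t" "t \<le> 1"
    then show "\<exists>S''\<in>Y. \<forall>R\<in>X. t * - plan_payoff G lam \<nu> n R S + (1 - t) * - plan_payoff G lam \<nu> n R S'
        \<le> - plan_payoff G lam \<nu> n R S''"
      by (intro bexI[OF _ convex_Y[of S S' t]]) (auto simp: plan_payoff_affine2)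
  qed
  have compact: "compact X" "X \<noteq> {}" "compact Y" "Y \<noteq> {}"
    using plan1 plan2 unfolding X_def Y_def
    by (auto intro!: compact_plans closed_range_pmf)
  obtain v R S where R: "R \<in> X" "\<forall>S\<in>Y. v \<le> plan_payoff G lam \<nu> n R S"
    and S: "S \<in> Y" "\<forall>R\<in>X. plan_payoff G lam \<nu> n R S \<le> v"
    using minimax_compact_convexlike[OF compact continuous_on_plan_payoff1
        continuous_on_plan_payoff2 conc conv] by blast
  \<comment> \<open>Optimal plans are turned back into strategies; for player 2 the initial law is
    recovered as well.\<close>
  from R(1) obtain \<sigma> where "R = plan1 P p \<sigma>"
    unfolding X_def by (elim plansE) auto
  moreover from S(1) obtain q \<tau> where "S = plan2 Q q \<tau>"
    unfolding Y_def by (elim plansE) auto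
  ultimately have "\<forall>y. v \<le> dual2_payoff G P Q n lam p \<nu> \<sigma> y"
    "\<forall>\<sigma>'. dual2_payoff G P Q n lam p \<nu> \<sigma>' (q, \<tau>) \<le> v"
    using R(2) S(2) plan1 plan2 by (auto simp: dual2_payoff_eq_plan_payoff)
  then show ?thesis
    unfolding is_game_value_def guarantees_max_def guarantees_min_def by blast
qed


subsection \<open>The linear program of the type 2 dual game\<close>

text \<open>No probability of \<open>a\<close> multiplies \<open>U\<close>: the continuation is
  unnormalized and already contains player 1's contribution to reaching the successor, just as
  \<open>reward\<close> does.\<close>

definition action_value where
  "action_value G Q lam R U J b = reward G lam R J b
     + (\<Sum>l\<in>UNIV. \<Sum>a\<in>UNIV. pmf (Q a b (cur_state J)) l * U (Step J a b l))"

text \<open>Summation by parts along the stages: \<open>U\<close> acts as a potential.\<close>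

lemma plan_payoff_potential:
  fixes G :: "'k::finite \<Rightarrow> 'l::finite \<Rightarrow> 'a::finite \<Rightarrow> 'b::finite \<Rightarrow> real"
  assumes sum_S: "\<And>J. (\<Sum>b\<in>UNIV. S J b) = weight (\<lambda>a b. b) Q r S J"
    and U: "\<And>J. stage J = Suc n \<Longrightarrow> U J = 0"
  shows "plan_payoff G lam \<nu> n R S = (\<Sum>l\<in>UNIV. r l * (\<nu> l + U (Init l)))
    + (\<Sum>t<n. \<Sum>J | stage J = Suc t. \<Sum>b\<in>UNIV. S J b * (action_value G Q lam R U J b - U J))"
proof -
  \<comment> \<open>The total potential at stage \<open>t + 1\<close>. Since \<open>S J b\<close>
    times a transition probability is the weight of the successor, the continuation terms of one
    stage add up to \<open>W\<close> of the next, and the differences telescope.\<close>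
  define W where "W t = (\<Sum>J | stage J = Suc t. weight (\<lambda>a b. b) Q r S J * U J)" for t
  have "(\<Sum>J | stage J = Suc t. \<Sum>b\<in>UNIV. S J b * (action_value G Q lam R U J b - U J))
      = (\<Sum>J | stage J = Suc t. \<Sum>b\<in>UNIV. S J b * reward G lam R J b) + W (Suc t) - W t" for t
  proof -
    have "(\<Sum>b\<in>UNIV. S J b * (action_value G Q lam R U J b - U J))
        = (\<Sum>b\<in>UNIV. S J b * reward G lam R J b)
          + (\<Sum>a\<in>UNIV. \<Sum>b\<in>UNIV. \<Sum>l\<in>UNIV. weight (\<lambda>a b. b) Q r S (Step J a b l) * U (Step J a b l))
          - weight (\<lambda>a b. b) Q r S J * U J" for J
    proof -
      have "(\<Sum>b\<in>UNIV. S J b * (\<Sum>l\<in>UNIV. \<Sum>a\<in>UNIV. pmf (Q a b (cur_state J)) l * U (Step J a b l)))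
          = (\<Sum>b\<in>UNIV. \<Sum>a\<in>UNIV. \<Sum>l\<in>UNIV. weight (\<lambda>a b. b) Q r S (Step J a b l) * U (Step J a b l))"
        unfolding sum_distrib_left
        by (subst sum.swap[of _ UNIV UNIV]) (simp add: mult_ac)
      also have "\<dots> = (\<Sum>a\<in>UNIV. \<Sum>b\<in>UNIV. \<Sum>l\<in>UNIV.
          weight (\<lambda>a b. b) Q r S (Step J a b l) * U (Step J a b l))"
        by (rule sum.swap)
      finally show ?thesis unfolding action_value_def
        by (simp add: algebra_simps sum.distrib sum_subtractf flip: sum_S sum_distrib_left)
    qed
    then show ?thesis
      unfolding W_def sum_stage_Suc_Suc by (simp add: sum.distrib sum_subtractf)
  qed
  then have "(\<Sum>t<n. \<Sum>J | stage J = Suc t. \<Sum>b\<in>UNIV.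
        S J b * (action_value G Q lam R U J b - U J))
      = (\<Sum>t<n. \<Sum>J | stage J = Suc t. \<Sum>b\<in>UNIV. S J b * reward G lam R J b)
        + (\<Sum>t<n. W (Suc t) - W t)"
    by (simp add: sum.distrib add_diff_eq[symmetric])
  also have "(\<Sum>t<n. W (Suc t) - W t) = W n - W 0"
    by (rule sum_lessThan_telescope)
  also have "W n = 0" by (simp add: W_def U)
  also have "W 0 = (\<Sum>l\<in>UNIV. r l * U (Init l))" by (simp add: W_def sum_stage_Suc_0)
  finally show ?thesis
    by (simp add: plan_payoff_def sum_S distrib_left sum.distrib mult.commute)
qed

lemma lp2_feasible_iff:
  "lp2_feasible G P Q n lam p \<nu> R U U0 \<longleftrightarrow>
     (\<forall>l. U0 \<le> \<nu> l + U (Init l)) \<and>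
     (\<forall>J b. stage J \<le> n \<longrightarrow> U J \<le> action_value G Q lam R U J b) \<and>
     (\<forall>I. stage I \<le> n \<longrightarrow> (\<Sum>a\<in>UNIV. R I a) = weight (\<lambda>a b. a) P (pmf p) R I) \<and>
     (\<forall>J. stage J = Suc n \<longrightarrow> U J = 0) \<and>
     (\<forall>I a. stage I \<le> n \<longrightarrow> 0 \<le> R I a)"
  unfolding lp2_feasible_def action_value_def reward_def weight1_eq_weight by simp

text \<open>Weak duality: feasibility of \<open>U\<close> makes every bracket in
  \<open>plan_payoff_potential\<close> nonnegative, and the initial term is an average of numbers
  that are at least \<open>U0\<close>.\<close>

lemma lp2_feasible_le_plan_payoff:
  assumes feas: "lp2_feasible G P Q n lam p \<nu> R U U0"
  shows "U0 \<le> plan_payoff G lam \<nu> n R (plan2 Q q \<tau>)"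
proof -
  have U: "\<And>J. stage J = Suc n \<Longrightarrow> U J = 0" and U0: "\<And>l. U0 \<le> \<nu> l + U (Init l)"
    and val: "\<And>J b. stage J \<le> n \<Longrightarrow> U J \<le> action_value G Q lam R U J b"
    using feas unfolding lp2_feasible_iff by auto
  have "U0 = (\<Sum>l\<in>UNIV. pmf q l * U0)" by (simp add: sum_pmf_UNIV flip: sum_distrib_right)
  also have "\<dots> \<le> (\<Sum>l\<in>UNIV. pmf q l * (\<nu> l + U (Init l)))"
    by (intro sum_mono mult_left_mono U0 pmf_nonneg)
  also have "\<dots> \<le> (\<Sum>l\<in>UNIV. pmf q l * (\<nu> l + U (Init l)))
      + (\<Sum>t<n. \<Sum>J | stage J = Suc t. \<Sum>b\<in>UNIV.
          plan2 Q q \<tau> J b * (action_value G Q lam R U J b - U J))"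
  proof -
    have "0 \<le> (\<Sum>t<n. \<Sum>J | stage J = Suc t. \<Sum>b\<in>UNIV.
        plan2 Q q \<tau> J b * (action_value G Q lam R U J b - U J))"
      using val by (intro sum_nonneg mult_nonneg_nonneg plan_of_nonneg) auto
    then show ?thesis by simp
  qed
  also have "\<dots> = plan_payoff G lam \<nu> n R (plan2 Q q \<tau>)"
    by (rule plan_payoff_potential[OF sum_plan_of, symmetric]) (rule U)
  finally show ?thesis .
qed

text \<open>Dynamic programming for player 2 against a fixed \<open>R\<close>; the number counts the
  stages still to be played.\<close>

primrec cost_to_go ::
  "('k::finite \<Rightarrow> 'l::finite \<Rightarrow> 'a::finite \<Rightarrow> 'b::finite \<Rightarrow> real) \<Rightarrow> ('a \<Rightarrow> 'b \<Rightarrow> 'l \<Rightarrow> 'l pmf) \<Rightarrow> real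
    \<Rightarrow> (('k, 'a, 'b) info \<Rightarrow> 'a \<Rightarrow> real) \<Rightarrow> nat \<Rightarrow> ('l, 'a, 'b) info \<Rightarrow> real" where
  "cost_to_go G Q lam R 0 = (\<lambda>J. 0)"
| "cost_to_go G Q lam R (Suc m) =
     (\<lambda>J. MIN b. action_value G Q lam R (cost_to_go G Q lam R m) J b)"

text \<open>The tight case of the preceding bound. Against a pure best response every summand in
  \<open>plan_payoff_potential\<close> is zero, and only the potential at the best initial state
  remains.\<close>

lemma best_response:
  fixes G :: "'k::finite \<Rightarrow> 'l::finite \<Rightarrow> 'a::finite \<Rightarrow> 'b::finite \<Rightarrow> real"
    and Q :: "'a \<Rightarrow> 'b \<Rightarrow> 'l \<Rightarrow> 'l pmf"
  shows "\<exists>U q \<tau>. (\<forall>l. plan_payoff G lam \<nu> n R (plan2 Q q \<tau>) \<le> \<nu> l + U (Init l)) \<and>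
    (\<forall>J b. stage J \<le> n \<longrightarrow> U J \<le> action_value G Q lam R U J b) \<and>
    (\<forall>J. stage J = Suc n \<longrightarrow> U J = 0)"
proof -
  \<comment> \<open>At stage \<open>t\<close> there remain \<open>n + 1 - t\<close> stages to play,
    counting the current one, so \<open>U\<close> vanishes at stage \<open>n + 1\<close> as the
    program demands.\<close>
  define U where "U J = cost_to_go G Q lam R (Suc n - stage J) J" for J
  have U_rec: "U J = (MIN b. action_value G Q lam R U J b)" if "stage J \<le> n" for J
    using that by (simp add: U_def Suc_diff_le action_value_def)
  define \<beta> where "\<beta> J = (SOME b. action_value G Q lam R U J b = U J)" for J
  have \<beta>: "action_value G Q lam R U J (\<beta> J) = U J" if "stage J \<le> n" for J
  proof -
    have "(MIN b. action_value G Q lam R U J b) \<in> range (action_value G Q lam R U J)"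
      by (intro Min_in) auto
    then obtain b where "(MIN b. action_value G Q lam R U J b) = action_value G Q lam R U J b"
      by (rule rangeE)
    then have "\<exists>b. action_value G Q lam R U J b = U J" using U_rec[OF that] by metis
    then show ?thesis unfolding \<beta>_def by (rule someI_ex)
  qed
  obtain l0 where l0: "\<And>l. \<nu> l0 + U (Init l0) \<le> \<nu> l + U (Init l)"
  proof -
    have "(MIN l. \<nu> l + U (Init l)) \<in> range (\<lambda>l. \<nu> l + U (Init l))"
      by (intro Min_in) auto
    then obtain l0 where l0: "(MIN l. \<nu> l + U (Init l)) = \<nu> l0 + U (Init l0)"
      by (rule rangeE)
    have "\<nu> l0 + U (Init l0) \<le> \<nu> l + U (Init l)" for l
      unfolding l0[symmetric] by (intro Min_le) auto
    then show thesis by (rule that)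
  qed
  let ?q = "return_pmf l0" and ?\<tau> = "\<lambda>J. return_pmf (\<beta> J)"
  have Un: "U J = 0" if "stage J = Suc n" for J using that by (simp add: U_def)
  have "plan_payoff G lam \<nu> n R (plan2 Q ?q ?\<tau>)
      = (\<Sum>l\<in>UNIV. pmf ?q l * (\<nu> l + U (Init l)))
      + (\<Sum>t<n. \<Sum>J | stage J = Suc t. \<Sum>b\<in>UNIV.
          plan2 Q ?q ?\<tau> J b * (action_value G Q lam R U J b - U J))"
    by (rule plan_payoff_potential[OF sum_plan_of]) (rule Un)
  \<comment> \<open>The plan is zero off the minimizing action \<open>\<beta> J\<close>, and at that
    action the bracket is zero.\<close>
  also have "(\<Sum>t<n. \<Sum>J | stage J = Suc t. \<Sum>b\<in>UNIV.
          plan2 Q ?q ?\<tau> J b * (action_value G Q lam R U J b - U J)) = 0"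
    by (intro sum.neutral ballI) (auto simp: plan_of_def \<beta> indicator_def)
  also have "(\<Sum>l\<in>UNIV. pmf ?q l * (\<nu> l + U (Init l))) = \<nu> l0 + U (Init l0)"
    by (simp add: pmf_return indicator_def if_distrib[of "\<lambda>x. x * _"] sum.delta cong: if_cong)
  finally have payoff: "plan_payoff G lam \<nu> n R (plan2 Q ?q ?\<tau>) = \<nu> l0 + U (Init l0)"
    by (simp only: add_0_right)
  have "U J \<le> action_value G Q lam R U J b" if "stage J \<le> n" for J b
    unfolding U_rec[OF that] by (intro Min_le) auto
  then show ?thesis using payoff l0 Un by metis
qed

text \<open>Turns a bound stated for the variables \<open>R\<close> into a guarantee of an actual
  strategy. Agreement up to stage \<open>n\<close> suffices, because the payoff reads the plan only
  there.\<close>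

lemma lp2_feasible_induced:
  assumes "lp2_feasible G P Q n lam p \<nu> R U U0"
  shows "\<exists>\<sigma>. induced_by_R P n p R \<sigma>"
    and "induced_by_R P n p R \<sigma> \<Longrightarrow> stage I \<le> n \<Longrightarrow> R I a = plan1 P p \<sigma> I a"
proof -
  have R: "\<And>I a. stage I \<le> n \<Longrightarrow> 0 \<le> R I a"
    "\<And>I. stage I \<le> n \<Longrightarrow> (\<Sum>a\<in>UNIV. R I a) = weight (\<lambda>a b. a) P (pmf p) R I"
    using assms unfolding lp2_feasible_iff by auto
  obtain \<tau> where "\<forall>I. (\<forall>a. 0 \<le> R I a) \<longrightarrow>
      (\<Sum>a\<in>UNIV. R I a) = weight (\<lambda>a b. a) P (pmf p) R I \<longrightarrow>
      weight (\<lambda>a b. a) P (pmf p) R I \<noteq> 0 \<longrightarrow>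
      (\<forall>a. pmf (\<tau> I) a = R I a / weight (\<lambda>a b. a) P (pmf p) R I)"
    using induced_exists by blast
  then show "\<exists>\<sigma>. induced_by_R P n p R \<sigma>"
    unfolding induced_by_R_def weight1_eq_weight using R by blast
  show "R I a = plan1 P p \<sigma> I a" if "induced_by_R P n p R \<sigma>" "stage I \<le> n"
    using that R unfolding induced_by_R_def weight1_eq_weight
    by (intro induced_imp_plan_of[where n = n]) auto
qed

text \<open>No feasible \<open>U0\<close> exceeds \<open>v\<close>, as one sees by playing the
  induced strategy against player 2's optimal pair. Conversely \<open>v\<close> is feasible with the
  plan of an optimal \<open>\<sigma>0\<close> and the matching cost-to-go. Weak duality then makes
  any strategy induced by an optimal \<open>R\<close> guarantee \<open>v\<close>.\<close>

theorem dual2_lp: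
  fixes G :: "'k::finite \<Rightarrow> 'l::finite \<Rightarrow> 'a::finite \<Rightarrow> 'b::finite \<Rightarrow> real"
    and P :: "'a \<Rightarrow> 'b \<Rightarrow> 'k \<Rightarrow> 'k pmf" and Q :: "'a \<Rightarrow> 'b \<Rightarrow> 'l \<Rightarrow> 'l pmf"
  shows "(\<exists>w. is_game_value (dual2_payoff G P Q n lam p \<nu>) w \<and>
      (\<exists>R U. lp2_optimal G P Q n lam p \<nu> R U w)) \<and>
    (\<forall>R U U0. lp2_optimal G P Q n lam p \<nu> R U U0 \<longrightarrow>
      (\<exists>\<sigma>. induced_by_R P n p R \<sigma>) \<and>
      (\<forall>\<sigma>. induced_by_R P n p R \<sigma> \<longrightarrow> optimal_max (dual2_payoff G P Q n lam p \<nu>) \<sigma>))"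
proof -
  obtain v where v: "is_game_value (dual2_payoff G P Q n lam p \<nu>) v"
    using dual2_game_value_exists by blast
  then obtain \<sigma>0 q0 \<tau>0 where
    max: "\<And>q \<tau>. v \<le> plan_payoff G lam \<nu> n (plan1 P p \<sigma>0) (plan2 Q q \<tau>)" and
    min: "\<And>\<sigma>. plan_payoff G lam \<nu> n (plan1 P p \<sigma>) (plan2 Q q0 \<tau>0) \<le> v"
    unfolding is_game_value_def guarantees_max_def guarantees_min_def
    by (auto simp: dual2_payoff_eq_plan_payoff)
  have le: "U0 \<le> v" if feas: "lp2_feasible G P Q n lam p \<nu> R U U0" for R U U0
  proof -
    obtain \<sigma> where \<sigma>: "induced_by_R P n p R \<sigma>" using lp2_feasible_induced(1)[OF feas] by blast
    have "U0 \<le> plan_payoff G lam \<nu> n R (plan2 Q q0 \<tau>0)"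
      by (rule lp2_feasible_le_plan_payoff[OF feas])
    also have "\<dots> = plan_payoff G lam \<nu> n (plan1 P p \<sigma>) (plan2 Q q0 \<tau>0)"
      by (intro plan_payoff_cong lp2_feasible_induced(2)[OF feas \<sigma>])
    also have "\<dots> \<le> v" by (rule min)
    finally show ?thesis .
  qed
  obtain U1 q1 \<tau>1 where
    U1: "\<forall>l. plan_payoff G lam \<nu> n (plan1 P p \<sigma>0) (plan2 Q q1 \<tau>1) \<le> \<nu> l + U1 (Init l)"
      "\<forall>J b. stage J \<le> n \<longrightarrow> U1 J \<le> action_value G Q lam (plan1 P p \<sigma>0) U1 J b"
      "\<forall>J. stage J = Suc n \<longrightarrow> U1 J = 0"
    using best_response by blast
  \<comment> \<open>The objective is set to \<open>v\<close>, which lies below the best-response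
    payoff because \<open>\<sigma>0\<close> guarantees it.\<close>
  have "v \<le> \<nu> l + U1 (Init l)" for l
    using U1(1) max[of q1 \<tau>1] by (blast intro: order.trans)
  then have "lp2_feasible G P Q n lam p \<nu> (plan1 P p \<sigma>0) U1 v"
    unfolding lp2_feasible_iff
    using U1(2,3) by (simp add: sum_plan_of plan_of_nonneg)
  then have opt: "lp2_optimal G P Q n lam p \<nu> (plan1 P p \<sigma>0) U1 v"
    unfolding lp2_optimal_def using le by blast
  have "\<exists>\<sigma>. induced_by_R P n p R \<sigma>" if "lp2_optimal G P Q n lam p \<nu> R U U0" for R U U0
    using that lp2_feasible_induced(1) unfolding lp2_optimal_def by blast
  moreover have "optimal_max (dual2_payoff G P Q n lam p \<nu>) \<sigma>"
    if RU: "lp2_optimal G P Q n lam p \<nu> R U U0" and \<sigma>: "induced_by_R P n p R \<sigma>" for R U U0 \<sigma>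
  proof -
    have feas: "lp2_feasible G P Q n lam p \<nu> R U U0" using RU by (simp add: lp2_optimal_def)
    have "v \<le> U0" using RU opt unfolding lp2_optimal_def by blast
    have "v \<le> dual2_payoff G P Q n lam p \<nu> \<sigma> (q, \<tau>)" for q \<tau>
    proof -
      note \<open>v \<le> U0\<close>
      also have "U0 \<le> plan_payoff G lam \<nu> n R (plan2 Q q \<tau>)"
        by (rule lp2_feasible_le_plan_payoff[OF feas])
      also have "\<dots> = plan_payoff G lam \<nu> n (plan1 P p \<sigma>) (plan2 Q q \<tau>)"
        by (intro plan_payoff_cong lp2_feasible_induced(2)[OF feas \<sigma>])
      finally show ?thesis by (simp add: dual2_payoff_eq_plan_payoff)
    qed
    with v show ?thesis
      unfolding optimal_max_def guarantees_max_def by auto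
  qed
  ultimately show ?thesis using v opt by blast
qed

subsection \<open>Exchanging the players\<close>

text \<open>Only the action pairs are exchanged. A full history additionally needs its state pairs
  exchanged, by \<open>map_info prod.swap\<close>.\<close>

primrec swap_info :: "('s, 'a, 'b) info \<Rightarrow> ('s, 'b, 'a) info" where
  "swap_info (Init s) = Init s"
| "swap_info (Step I a b s) = Step (swap_info I) b a s"

lemma swap_swap_info [simp]: "swap_info (swap_info I) = I"
  by (induction I) auto

lemma stage_swap_info [simp]: "stage (swap_info I) = stage I"
  by (induction I) auto

lemma first_state_swap_info [simp]: "first_state (swap_info I) = first_state I"
  by (induction I) auto

lemma cur_state_swap_info [simp]: "cur_state (swap_info I) = cur_state I"
  by (cases I) auto

lemma actions_swap_info [simp]: "actions (swap_info I) = map prod.swap (actions I)"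
  by (induction I) auto

lemma map_info_swap_info [simp]: "map_info f (swap_info I) = swap_info (map_info f I)"
  by (induction I) auto

lemma first_state_map_info [simp]: "first_state (map_info f I) = f (first_state I)"
  by (induction I) auto

lemma all_swap_info: "(\<forall>I. \<Phi> (swap_info I)) \<longleftrightarrow> (\<forall>I. \<Phi> I)"
  by (metis swap_swap_info)

lemma sum_same_actions_swap_info:
  "(\<Sum>J | actions J = actions (swap_info I). f J) = (\<Sum>J | actions J = actions I. f (swap_info J))"
  by (rule sum.reindex_bij_witness[of _ swap_info swap_info])
    (auto simp: comp_def dest: arg_cong[of _ _ "map prod.swap"])

lemma reach_swap_info:
  "reach own K r \<sigma> (swap_info I)
    = reach (\<lambda>b a. own a b) (\<lambda>b a. K a b) r (\<lambda>I. \<sigma> (swap_info I)) I"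
  by (induction I) auto

lemma weight_swap_info:
  "weight2 Q q S (swap_info J) = weight1 (\<lambda>b a. Q a b) q (\<lambda>J. S (swap_info J)) J"
  by (cases J) auto

lemma swap_history_involutive:
  "swap_info (map_info prod.swap (swap_info (map_info prod.swap H))) = H"
  by (simp add: info.map_comp comp_def info.map_ident)

text \<open>Checked pointwise: by \<open>pmf_play\<close> both sides are the product of the same two
  reach probabilities, with the factors in opposite order.\<close>

lemma play_swap_info:
  "play (\<lambda>b a. Q a b) (\<lambda>b a. P a b) q p (\<lambda>J. \<tau> (swap_info J)) (\<lambda>I. \<sigma> (swap_info I)) t
    = map_pmf (\<lambda>H. swap_info (map_info prod.swap H)) (play P Q p q \<sigma> \<tau> t)" (is "?L = map_pmf ?f ?M")
proof (rule pmf_eqI)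
  fix H
  have "inj ?f" by (rule inj_on_inverseI) (rule swap_history_involutive)
  then have "pmf (map_pmf ?f ?M) (?f (swap_info (map_info prod.swap H)))
      = pmf ?M (swap_info (map_info prod.swap H))"
    by (rule pmf_map_inj')
  then show "pmf ?L H = pmf (map_pmf ?f ?M) H"
    unfolding swap_history_involutive
    by (simp add: pmf_play reach_swap_info info.map_comp comp_def)
qed

lemma total_payoff_swap_info:
  "total_payoff (\<lambda>l k b a. - G k l a b) lam (swap_info (map_info prod.swap H))
    = - total_payoff G lam H"
  by (induction H) auto

lemma dual1_payoff_eq_dual2_payoff:
  "dual1_payoff G P Q n lam \<mu> q (p, \<sigma>) \<tau>
    = - dual2_payoff (\<lambda>l k b a. - G k l a b) (\<lambda>b a. Q a b) (\<lambda>b a. P a b) n lam q (\<lambda>k. - \<mu> k)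
        (\<lambda>J. \<tau> (swap_info J)) (p, \<lambda>I. \<sigma> (swap_info I))"
proof -
  have "measure_pmf.expectation (play P Q p q \<sigma> \<tau> n)
        (\<lambda>H. - total_payoff G lam H - \<mu> (fst (first_state H)))
      = - measure_pmf.expectation (play P Q p q \<sigma> \<tau> n)
        (\<lambda>H. \<mu> (fst (first_state H)) + total_payoff G lam H)"
    by (subst Bochner_Integration.integral_minus[symmetric]) (simp add: algebra_simps)
  then show ?thesis
    by (simp add: dual1_payoff_def dual2_payoff_def play_swap_info total_payoff_swap_info)
qed

text \<open>Negating \<open>Z\<close>, \<open>Z0\<close>, \<open>G\<close> and \<open>\<mu>\<close>
  together reverses the payoff inequalities. The variables \<open>S\<close> are only reindexed,
  since their own constraints do not involve payoffs.\<close>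

lemma lp1_feasible_iff_lp2_feasible:
  "lp1_feasible G P Q n lam \<mu> q S Z Z0 \<longleftrightarrow>
   lp2_feasible (\<lambda>l k b a. - G k l a b) (\<lambda>b a. Q a b) (\<lambda>b a. P a b) n lam q (\<lambda>k. - \<mu> k)
     (\<lambda>J. S (swap_info J)) (\<lambda>I. - Z (swap_info I)) (- Z0)"
proof -
  have "(\<Sum>J | actions J = actions I. \<Sum>b\<in>UNIV. S (swap_info J) b * lam ^ (stage I - 1) *
          - G (cur_state I) (cur_state J) a b)
        + (\<Sum>k\<in>UNIV. \<Sum>b\<in>UNIV. pmf (P a b (cur_state I)) k * - Z (swap_info (Step I b a k)))
        \<ge> - Z (swap_info I) \<longleftrightarrow>
      (\<Sum>J | actions J = actions (swap_info I). \<Sum>b\<in>UNIV. S J b * lam ^ (stage (swap_info I) - 1) *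
          G (cur_state (swap_info I)) (cur_state J) a b)
        + (\<Sum>k\<in>UNIV. \<Sum>b\<in>UNIV. pmf (P a b (cur_state (swap_info I))) k * Z (Step (swap_info I) a b k))
        \<le> Z (swap_info I)" for I a
    unfolding sum_same_actions_swap_info by (simp add: sum_negf) argo
  then have "(\<forall>I a. stage I \<le> n \<longrightarrow>
        (\<Sum>J | actions J = actions I. \<Sum>b\<in>UNIV. S (swap_info J) b * lam ^ (stage I - 1) *
          - G (cur_state I) (cur_state J) a b)
        + (\<Sum>k\<in>UNIV. \<Sum>b\<in>UNIV. pmf (P a b (cur_state I)) k * - Z (swap_info (Step I b a k)))
        \<ge> - Z (swap_info I)) \<longleftrightarrow>
      (\<forall>I a. stage I \<le> n \<longrightarrow>
        (\<Sum>J | actions J = actions I. \<Sum>b\<in>UNIV. S J b * lam ^ (stage I - 1) *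
          G (cur_state I) (cur_state J) a b)
        + (\<Sum>k\<in>UNIV. \<Sum>b\<in>UNIV. pmf (P a b (cur_state I)) k * Z (Step I a b k)) \<le> Z I)"
    by (subst (2) all_swap_info[symmetric]) simp
  moreover have "(\<forall>J. stage J \<le> n \<longrightarrow> (\<Sum>b\<in>UNIV. S J b) = weight2 Q q S J) \<longleftrightarrow>
      (\<forall>J. stage J \<le> n \<longrightarrow> (\<Sum>b\<in>UNIV. S (swap_info J) b)
        = weight1 (\<lambda>b a. Q a b) q (\<lambda>J. S (swap_info J)) J)"
    by (subst all_swap_info[symmetric]) (simp add: weight_swap_info)
  moreover have "(\<forall>I. stage I = n + 1 \<longrightarrow> Z I = 0) \<longleftrightarrow> (\<forall>I. stage I = n + 1 \<longrightarrow> - Z (swap_info I) = 0)"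
    by (subst all_swap_info[symmetric]) simp
  moreover have "(\<forall>J b. stage J \<le> n \<longrightarrow> 0 \<le> S J b) \<longleftrightarrow> (\<forall>J b. stage J \<le> n \<longrightarrow> 0 \<le> S (swap_info J) b)"
    by (subst all_swap_info[symmetric]) simp
  moreover have "(\<forall>k. \<mu> k + Z (Init k) \<le> Z0) \<longleftrightarrow> (\<forall>k. - \<mu> k + - Z (swap_info (Init k)) \<ge> - Z0)"
    by (intro iff_allI) auto
  ultimately show ?thesis unfolding lp1_feasible_def lp2_feasible_def by argo
qed

lemma lp1_optimal_iff_lp2_optimal:
  "lp1_optimal G P Q n lam \<mu> q S Z Z0 \<longleftrightarrow>
   lp2_optimal (\<lambda>l k b a. - G k l a b) (\<lambda>b a. Q a b) (\<lambda>b a. P a b) n lam q (\<lambda>k. - \<mu> k)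
     (\<lambda>J. S (swap_info J)) (\<lambda>I. - Z (swap_info I)) (- Z0)" (is "_ \<longleftrightarrow> lp2_optimal ?G ?Q ?P n lam q ?\<nu> _ _ _")
proof -
  have "(\<forall>S' Z' Z0'. lp1_feasible G P Q n lam \<mu> q S' Z' Z0' \<longrightarrow> Z0 \<le> Z0') \<longleftrightarrow>
      (\<forall>R' U' U0'. lp2_feasible ?G ?Q ?P n lam q ?\<nu> R' U' U0' \<longrightarrow> U0' \<le> - Z0)" (is "?l \<longleftrightarrow> ?r")
  proof
    assume l: ?l
    show ?r
    proof (intro allI impI)
      fix R' U' U0'
      assume "lp2_feasible ?G ?Q ?P n lam q ?\<nu> R' U' U0'"
      then have "lp1_feasible G P Q n lam \<mu> q (\<lambda>J. R' (swap_info J)) (\<lambda>I. - U' (swap_info I)) (- U0')"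
        by (simp add: lp1_feasible_iff_lp2_feasible)
      then have "Z0 \<le> - U0'" using l by blast
      then show "U0' \<le> - Z0" by simp
    qed
  next
    assume r: ?r
    show ?l
    proof (intro allI impI)
      fix S' Z' Z0'
      assume "lp1_feasible G P Q n lam \<mu> q S' Z' Z0'"
      then have "- Z0' \<le> - Z0" using r unfolding lp1_feasible_iff_lp2_feasible by blast
      then show "Z0 \<le> Z0'" by simp
    qed
  qed
  then show ?thesis
    unfolding lp1_optimal_def lp2_optimal_def lp1_feasible_iff_lp2_feasible[of G P Q n lam \<mu> q S Z Z0]
    by blast
qed

lemma induced_by_S_iff_induced_by_R:
  "induced_by_S Q n q S \<tau> \<longleftrightarrow>
   induced_by_R (\<lambda>b a. Q a b) n q (\<lambda>J. S (swap_info J)) (\<lambda>J. \<tau> (swap_info J))"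
  unfolding induced_by_S_def induced_by_R_def
  by (subst all_swap_info[symmetric]) (simp add: weight_swap_info)

lemma surj_swap_info_arg: "surj (\<lambda>f I. f (swap_info I))"
  by (rule surjI[where f = "\<lambda>f I. f (swap_info I)"]) simp

text \<open>Surjectivity of \<open>\<phi>\<close> and \<open>\<psi>\<close> ensures that a guarantee
  against all translated opponents is one against all opponents, and that every strategy of the
  other game is a translation.\<close>

lemma negated_game:
  assumes pay: "\<And>x y. pay x y = - pay' (\<phi> y) (\<psi> x)" and "surj \<phi>" "surj \<psi>"
  shows "is_game_value pay v \<longleftrightarrow> is_game_value pay' (- v)"
    and "optimal_min pay y \<longleftrightarrow> optimal_max pay' (\<phi> y)"
proof -
  have max: "guarantees_max pay' (\<phi> y) (- v) \<longleftrightarrow> guarantees_min pay y v" for y v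
  proof -
    have "(\<forall>x. - v \<le> pay' (\<phi> y) x) \<longleftrightarrow> (\<forall>x. - v \<le> pay' (\<phi> y) (\<psi> x))"
      using \<open>surj \<psi>\<close> by (metis surjD)
    then show ?thesis
      unfolding guarantees_max_def guarantees_min_def pay by (simp add: minus_le_iff)
  qed
  have min: "guarantees_min pay' (\<psi> x) (- v) \<longleftrightarrow> guarantees_max pay x v" for x v
  proof -
    have "(\<forall>y. pay' y (\<psi> x) \<le> - v) \<longleftrightarrow> (\<forall>y. pay' (\<phi> y) (\<psi> x) \<le> - v)"
      using \<open>surj \<phi>\<close> by (metis surjD)
    then show ?thesis
      unfolding guarantees_max_def guarantees_min_def pay by (simp add: le_minus_iff)
  qed
  have val: "is_game_value pay v \<longleftrightarrow> is_game_value pay' (- v)" for v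
    unfolding is_game_value_def using max min \<open>surj \<phi>\<close> \<open>surj \<psi>\<close> by (metis surjD)
  then show "is_game_value pay v \<longleftrightarrow> is_game_value pay' (- v)" .
  show "optimal_min pay y \<longleftrightarrow> optimal_max pay' (\<phi> y)"
    unfolding optimal_min_def optimal_max_def using val max by (metis minus_minus)
qed

theorem dual1_lp:
  fixes G :: "'k::finite \<Rightarrow> 'l::finite \<Rightarrow> 'a::finite \<Rightarrow> 'b::finite \<Rightarrow> real"
    and P :: "'a \<Rightarrow> 'b \<Rightarrow> 'k \<Rightarrow> 'k pmf" and Q :: "'a \<Rightarrow> 'b \<Rightarrow> 'l \<Rightarrow> 'l pmf"
  shows "(\<exists>w. is_game_value (dual1_payoff G P Q n lam \<mu> q) w \<and>
      (\<exists>S Z. lp1_optimal G P Q n lam \<mu> q S Z w)) \<and>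
    (\<forall>S Z Z0. lp1_optimal G P Q n lam \<mu> q S Z Z0 \<longrightarrow>
      (\<exists>\<tau>. induced_by_S Q n q S \<tau>) \<and>
      (\<forall>\<tau>. induced_by_S Q n q S \<tau> \<longrightarrow> optimal_min (dual1_payoff G P Q n lam \<mu> q) \<tau>))"
proof -
  let ?G = "\<lambda>l k b a. - G k l a b" and ?Q = "\<lambda>b a. Q a b" and ?P = "\<lambda>b a. P a b"
    and ?\<nu> = "\<lambda>k. - \<mu> k"
  let ?\<phi> = "\<lambda>\<tau> J. \<tau> (swap_info J)"
    and ?\<psi> = "\<lambda>(p :: 'k pmf, \<sigma> :: ('k, 'a, 'b) info \<Rightarrow> 'a pmf). (p, \<lambda>I. \<sigma> (swap_info I))"
  have "surj ?\<psi>"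
    by (rule surjI[where f = "\<lambda>(p, \<sigma>). (p, \<lambda>I. \<sigma> (swap_info I))"]) auto
  note game = negated_game[where pay = "dual1_payoff G P Q n lam \<mu> q"
      and pay' = "dual2_payoff ?G ?Q ?P n lam q ?\<nu>" and \<phi> = ?\<phi> and \<psi> = ?\<psi>,
      OF _ surj_swap_info_arg \<open>surj ?\<psi>\<close>]
  have pay: "dual1_payoff G P Q n lam \<mu> q x \<tau> = - dual2_payoff ?G ?Q ?P n lam q ?\<nu> (?\<phi> \<tau>) (?\<psi> x)"
    for x \<tau> by (cases x) (simp add: dual1_payoff_eq_dual2_payoff)
  note lp2 = dual2_lp[of ?G ?Q ?P n lam q ?\<nu>]
  obtain w R U where w: "is_game_value (dual2_payoff ?G ?Q ?P n lam q ?\<nu>) w"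
    and opt: "lp2_optimal ?G ?Q ?P n lam q ?\<nu> R U w"
    using lp2 by blast
  have "is_game_value (dual1_payoff G P Q n lam \<mu> q) (- w)"
    using w game(1)[OF pay] by simp
  moreover have "lp1_optimal G P Q n lam \<mu> q (?\<phi> R) (\<lambda>I. - U (swap_info I)) (- w)"
    using opt by (simp add: lp1_optimal_iff_lp2_optimal)
  moreover have "(\<exists>\<tau>. induced_by_S Q n q S \<tau>) \<and>
      (\<forall>\<tau>. induced_by_S Q n q S \<tau> \<longrightarrow> optimal_min (dual1_payoff G P Q n lam \<mu> q) \<tau>)"
    if "lp1_optimal G P Q n lam \<mu> q S Z Z0" for S Z Z0
  proof -
    have opt: "lp2_optimal ?G ?Q ?P n lam q ?\<nu> (?\<phi> S) (\<lambda>I. - Z (swap_info I)) (- Z0)"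
      using that by (simp add: lp1_optimal_iff_lp2_optimal)
    obtain \<tau> where "induced_by_R ?Q n q (?\<phi> S) \<tau>" using lp2 opt by blast
    \<comment> \<open>The exchange is an involution, so translating \<open>\<tau>\<close> back is
      again an application of \<open>?\<phi>\<close>.\<close>
    then have "induced_by_S Q n q S (?\<phi> \<tau>)" by (simp add: induced_by_S_iff_induced_by_R)
    moreover have "optimal_min (dual1_payoff G P Q n lam \<mu> q) \<tau>" if "induced_by_S Q n q S \<tau>" for \<tau>
      using lp2 opt that unfolding game(2)[OF pay] induced_by_S_iff_induced_by_R by blast
    ultimately show ?thesis by blast
  qed
  ultimately show ?thesis by blast
qed

theorem proposition3:
  fixes G :: "'k::finite \<Rightarrow> 'l::finite \<Rightarrow> 'a::finite \<Rightarrow> 'b::finite \<Rightarrow> real"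
    and P :: "'a \<Rightarrow> 'b \<Rightarrow> 'k \<Rightarrow> 'k pmf"
    and Q :: "'a \<Rightarrow> 'b \<Rightarrow> 'l \<Rightarrow> 'l pmf"
    and n :: nat and lam :: real
  assumes "\<And>k l a b. 0 \<le> G k l a b"
    and "n \<ge> 1" and "0 < lam" and "lam \<le> 1"
  shows
    "(\<forall>(p :: 'k pmf) (\<nu> :: 'l \<Rightarrow> real).
        (\<exists>w. is_game_value (dual2_payoff G P Q n lam p \<nu>) w \<and>
             (\<exists>R U. lp2_optimal G P Q n lam p \<nu> R U w)) \<and>
        (\<forall>R U U0. lp2_optimal G P Q n lam p \<nu> R U U0 \<longrightarrow>
             (\<exists>\<sigma>. induced_by_R P n p R \<sigma>) \<and>
             (\<forall>\<sigma>. induced_by_R P n p R \<sigma> \<longrightarrow>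
                  optimal_max (dual2_payoff G P Q n lam p \<nu>) \<sigma>))) \<and>
     (\<forall>(\<mu> :: 'k \<Rightarrow> real) (q :: 'l pmf).
        (\<exists>w. is_game_value (dual1_payoff G P Q n lam \<mu> q) w \<and>
             (\<exists>S Z. lp1_optimal G P Q n lam \<mu> q S Z w)) \<and>
        (\<forall>S Z Z0. lp1_optimal G P Q n lam \<mu> q S Z Z0 \<longrightarrow>
             (\<exists>\<tau>. induced_by_S Q n q S \<tau>) \<and>
             (\<forall>\<tau>. induced_by_S Q n q S \<tau> \<longrightarrow>
                  optimal_min (dual1_payoff G P Q n lam \<mu> q) \<tau>)))"
  by (intro conjI allI dual2_lp dual1_lp)

end
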